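(* Consider the multiple change point model of the context with $J$ fixed (not depending on $N$), satisfying conditions (M1)–(M6) stated there, and suppose the first stage estimators satisfy the first-stage consistency property stated there. Define independent random variables $L^*_1,\dots,L^*_J$ by $$L^*_j=\arg\min_{k\in\mathbb Z}Z_j(k),\qquad Z_j(k)=\begin{cases}|\Delta_j|(\varepsilon^*_{j,1}+\dots+\varepsilon^*_{j,k})+k\Delta_j^2/2,&k>0\\0,&k=0\\-|\Delta_j|(\varepsilon^*_{j-1,k+1}+\dots+\varepsilon^*_{j-1,0})+|k|\Delta_j^2/2,&k<0,\end{cases}$$ where for each $j=0,\dots,J$, $\{\varepsilon^*_{j,k}:k\in\mathbb Z\}$ is a set of i.i.d. random variables with the same distribution as $\mathcal E_j$. Then the deviations $\lambda_2(\tau_j,\hat\tau^{(2)}_j)$, $1\le j\le\hat J$, jointly converge to the distribution of $(L^*_1,\dots,L^*_J)$: for all integers $k_1,\dots,k_J$, as $N\to\infty$, $$\mathbb P\big[\hat J=J,\ \lambda_2(\tau_j,\hat\tau^{(2)}_j)=k_j\text{ for }1\le j\le J\big]\to\prod_{j=1}^J\mathbb P[L^*_j=k_j].$$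
   Context: Model. For each $N$ one observes $Y_i=\theta_i+\varepsilon_i$, $i=1,\dots,N$ (a triangular array; dependence on $N$ is suppressed). There are change points $1=\tau_0<\tau_1<\dots<\tau_J<\tau_{J+1}=N$ and levels $\nu_0,\dots,\nu_J$ with $\theta_i=\nu_j$ for $\tau_j<i\le\tau_{j+1}$ (and $\theta_1=\nu_0$). Conditions: (M1) $\max_i|\theta_i|\le\bar\theta$ for a constant $\bar\theta\in(0,\infty)$ not depending on $N$. (M2) $\min_{1\le j\le J}|\nu_j-\nu_{j-1}|\ge\underline\Delta$ for a constant $\underline\Delta>0$ not depending on $N$. (M3) There are $\Xi\in[0,1)$ and $C>0$ with $\delta_N:=\min_{0\le i\le J}(\tau_{i+1}-\tau_i)\ge CN^{1-\Xi}$ for all large $N$. (M4) $\varepsilon_1,\dots,\varepsilon_N$ are independent, centered and subgaussian with subgaussian parameters bounded by a constant $\sigma_{\max}>0$ not depending on $N$ (i.e. $\mathbb E e^{s\varepsilon_i}\le e^{s^2\sigma_{\max}^2/2}$ for all real $s$). (M5) The jump sizes $\Delta_j:=\nu_j-\nu_{j-1}$, $j=1,\dots,J$, are constants not depending on $N$. (M6) For every $0\le j\le J$, the variables $\varepsilon_{\tau_j+1},\dots,\varepsilon_{\tau_{j+1}}$ all have the same distribution as $\mathcal E_j$, where $\mathcal E_0,\dots,\mathcal E_J$ are fixed random variables whose distributions do not change with $N$. Intelligent sampling. Stage 1: let $N_1=K_1N^\gamma$ with $K_1>0$, $\gamma\in(\Xi,1)$, $N/N_1=o(\delta_N)$. From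 the subsample $\{Y_i: i \text{ a multiple of }\lfloor N/N_1\rfloor\}$ only, some procedure produces estimators $\hat J$ of $J$, $\hat\tau^{(1)}_1,\dots,\hat\tau^{(1)}_{\hat J}$ of the change points, and $\hat\nu^{(1)}_0,\dots,\hat\nu^{(1)}_{\hat J}$ of the levels. First-stage consistency property: $$\mathbb P\Big[\hat J=J,\ \max_{1\le i\le J}|\hat\tau^{(1)}_i-\tau_i|\le w(N),\ \max_{0\le i\le J}|\hat\nu^{(1)}_i-\nu_i|\le\rho_N\Big]\to1$$ for some sequences with $w(N)\to\infty$, $w(N)=o(\delta_N)$, $w(N)>cN^{1-\gamma}$ for some constant $c>0$, and $\rho_N\to0$. Stage 2: fix an integer $K>1$; let $S^{(2)}(\hat\tau^{(1)}_i)$ be the set of integers in $[\hat\tau^{(1)}_i-Kw(N),\hat\tau^{(1)}_i+Kw(N)]$ not divisible by $\lfloor N/N_1\rfloor$. For $i=1,\dots,\hat J$, $$\hat\tau^{(2)}_i=\arg\min_{d\in S^{(2)}(\hat\tau^{(1)}_i)}\ \sum_{j\in S^{(2)}(\hat\tau^{(1)}_i)}\big[Y_j-\hat\nu^{(1)}_{i-1}1(j\le d)-\hat\nu^{(1)}_i1(j>d)\big]^2 .$$ Signed counting distance: $\lambda_2(a,b)$ is the number of integers $i\in\{1,\dots,N\}$ with $a<i\le b$ that are not multiples of $\lfloor N/N_1\rfloor$ if $a\le b$, and minus the number of such integers with $b<i\le a$ otherwise.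
   Formalization: The form with |Δ_j| is false for downward jumps with asymmetric noise; it is proved when noise on both sides of each downward jump is symmetric, and in general with Δ_j replacing |Δ_j| as noise factor. The arg min defining L*_j is assumed almost surely unique. *)

theory Defs
  imports "HOL-Probability.Probability" "HOL-Library.Landau_Symbols"
begin

text \<open>The indices \<open>tau 0 = 1\<close> and \<open>tau (Suc J) = N\<close> are the two end points;
  the change points proper are \<open>tau 1, \<dots>, tau J\<close>.\<close>

definition piecewise_constant_signal ::
    "nat \<Rightarrow> nat \<Rightarrow> (nat \<Rightarrow> nat) \<Rightarrow> (nat \<Rightarrow> real) \<Rightarrow> (nat \<Rightarrow> real) \<Rightarrow> bool" where
  "piecewise_constant_signal N J tau nu theta \<longleftrightarrow>
     tau 0 = 1 \<and> tau (Suc J) = N \<and> (\<forall>j\<le>J. tau j < tau (Suc j)) \<and>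
     theta 1 = nu 0 \<and>
     (\<forall>j\<le>J. \<forall>i. tau j < i \<and> i \<le> tau (Suc j) \<longrightarrow> theta i = nu j)"

definition min_spacing :: "nat \<Rightarrow> (nat \<Rightarrow> nat) \<Rightarrow> real" where
  "min_spacing J tau = Min ((\<lambda>i. real (tau (Suc i)) - real (tau i)) ` {0..J})"

text \<open>The integrability clause is needed because the Bochner integral of a non-integrable
  function is 0.\<close>

definition subgaussian :: "'a measure \<Rightarrow> real \<Rightarrow> ('a \<Rightarrow> real) \<Rightarrow> bool" where
  "subgaussian M \<sigma> X \<longleftrightarrow>
     (\<forall>s. integrable M (\<lambda>\<omega>. exp (s * X \<omega>)) \<and>
          (\<integral>\<omega>. exp (s * X \<omega>) \<partial>M) \<le> exp (s\<^sup>2 * \<sigma>\<^sup>2 / 2))"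

definition subsample :: "nat \<Rightarrow> nat \<Rightarrow> nat set" where
  "subsample m N = {i \<in> {1..N}. m dvd i}"

text \<open>\<open>T\<close> is an \<open>S\<close>-valued statistic computed from the observations
  \<open>Y i\<close>, \<open>i \<in> I\<close>, only.\<close>

definition statistic_of ::
    "'a measure \<Rightarrow> nat set \<Rightarrow> (nat \<Rightarrow> 'a \<Rightarrow> real) \<Rightarrow> 'b measure \<Rightarrow> ('a \<Rightarrow> 'b) \<Rightarrow> bool" where
  "statistic_of M I Y S T \<longleftrightarrow>
     (\<exists>g \<in> measurable (PiM I (\<lambda>_. borel)) S. \<forall>\<omega>\<in>space M. T \<omega> = g (\<lambda>i\<in>I. Y i \<omega>))"

definition second_stage_set :: "nat \<Rightarrow> nat \<Rightarrow> real \<Rightarrow> real \<Rightarrow> nat set" where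
  "second_stage_set m N r t =
     {j \<in> {1..N}. t - r \<le> real j \<and> real j \<le> t + r \<and> \<not> m dvd j}"

text \<open>If the minimiser is not unique, \<^const>\<open>arg_min_on\<close> picks an unspecified one.\<close>

definition second_stage_estimator ::
    "(nat \<Rightarrow> real) \<Rightarrow> nat set \<Rightarrow> real \<Rightarrow> real \<Rightarrow> nat" where
  "second_stage_estimator y S a b =
     arg_min_on (\<lambda>d. \<Sum>j\<in>S. (y j - a * of_bool (j \<le> d) - b * of_bool (j > d))\<^sup>2) S"

definition lambda2 :: "nat \<Rightarrow> nat \<Rightarrow> nat \<Rightarrow> nat \<Rightarrow> int" where
  "lambda2 m N a b =
     (if a \<le> b then int (card {i \<in> {1..N}. a < i \<and> i \<le> b \<and> \<not> m dvd i})
      else - int (card {i \<in> {1..N}. b < i \<and> i \<le> a \<and> \<not> m dvd i}))"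

text \<open>Two-sided random walk with drift \<open>a\<^sup>2 / 2\<close>, driven by the noise \<open>a * r i\<close>
  for \<open>i > 0\<close> and \<open>- a * l i\<close> for \<open>i \<le> 0\<close>.\<close>

definition limit_process ::
    "real \<Rightarrow> (int \<Rightarrow> 'b \<Rightarrow> real) \<Rightarrow> (int \<Rightarrow> 'b \<Rightarrow> real) \<Rightarrow> int \<Rightarrow> 'b \<Rightarrow> real" where
  "limit_process a l r k \<omega> =
     (if k > 0 then a * (\<Sum>i\<in>{1..k}. r i \<omega>) + of_int k * a\<^sup>2 / 2
      else if k = 0 then 0
      else - a * (\<Sum>i\<in>{k+1..0}. l i \<omega>) + of_int \<bar>k\<bar> * a\<^sup>2 / 2)"

text \<open>The integer-valued random variable \<open>L\<close> is the arg min of \<open>Z\<close>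
  over all integers. The equivalence says that \<open>L \<omega>\<close> is a minimiser and that there is no
  other one, so the law of \<open>L\<close> is determined by the law of \<open>Z\<close>.\<close>

definition as_argmin :: "'b measure \<Rightarrow> (int \<Rightarrow> 'b \<Rightarrow> real) \<Rightarrow> ('b \<Rightarrow> int) \<Rightarrow> bool" where
  "as_argmin P Z L \<longleftrightarrow>
     L \<in> measurable P (count_space UNIV) \<and>
     (AE \<omega> in P. \<forall>k. is_arg_min (\<lambda>k. Z k \<omega>) (\<lambda>_. True) k \<longleftrightarrow> k = L \<omega>)"

definition symmetric_law :: "real measure \<Rightarrow> bool" where
  "symmetric_law \<mu> \<longleftrightarrow> distr \<mu> borel uminus = \<mu>"

end

theory Submission
  imports Defs "HOL-Real_Asymp.Real_Asymp"
begin

text \<open>Number the non-multiples of \<open>m\<close> around a change point \<open>\<tau>\<close> by the integers, so that the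
  non-multiple with number \<open>k\<close> is the one at \<open>\<lambda>\<^sub>2\<close>-distance \<open>k\<close> from \<open>\<tau>\<close>. On the event that the first
  stage is accurate to within \<open>\<rho>\<close>, half of the increment of the second-stage criterion from \<open>\<tau>\<close> to
  number \<open>k\<close> differs from the limiting walk, driven by the noise at the non-multiples, by at most
  \<open>\<rho>\<close> times a function of the noise in the window \<open>\<bar>k\<bar> \<le> R\<close>. Since this bound is deterministic,
  the dependence between the stages plays no role. A Chernoff bound, uniform in \<open>N\<close>, excludes
  minimisers outside the window. For large \<open>N\<close> the windows at different change
  points are disjoint, and the noise in them has exactly the law of the corresponding \<open>\<epsilon>\<^sup>*\<close>. So the
  probability in question lies, up to small errors, between the probabilities under the limit law of a
  window minimum by a clear margin and of an approximate window minimum. Letting the margin tend to 0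
  and then \<open>R\<close> to infinity, both tend to the probability that the limiting arg mins are the given
  integers, because the limiting arg min is almost surely unique. The variant with \<open>\<bar>\<Delta>\<^sub>j\<bar>\<close> reduces to
  the one with \<open>\<Delta>\<^sub>j\<close> by flipping the signs of the noise around the downward jumps.\<close>

section \<open>Counting the indices outside the subsample\<close>

definition nonmultiple_count :: "nat \<Rightarrow> nat \<Rightarrow> nat" where
  "nonmultiple_count m t = t - t div m"

text \<open>With \<open>k = 0\<close> for the largest non-multiple up to \<open>t\<close>; the \<open>n\<close>-th non-multiple of
  \<open>m \<ge> 2\<close>, counted from 0, is \<open>n + n div (m - 1) + 1\<close>.\<close>

definition nonmultiple_at :: "nat \<Rightarrow> nat \<Rightarrow> int \<Rightarrow> nat" where
  "nonmultiple_at m t k = (let n = nat (int (nonmultiple_count m t) + k) - 1 in n + n div (m - 1) + 1)"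

lemma nonmultiple_count_Suc: "nonmultiple_count m (Suc t) = (if m dvd Suc t then nonmultiple_count m t else Suc (nonmultiple_count m t))"
\<comment> \<open>In HOL \<open>t div 0\<close> is 0, and 0 divides no successor, so the formula
  counts correctly for \<open>m = 0\<close> as well.\<close>
proof (cases "m = 0")
  case False
  have "t div m \<le> t" by simp
  moreover have "m dvd Suc t \<Longrightarrow> Suc t div m = Suc (t div m)"
    by (simp add: div_Suc mod_eq_0_iff_dvd)
  moreover have "\<not> m dvd Suc t \<Longrightarrow> Suc t div m = t div m"
    by (simp add: div_Suc mod_eq_0_iff_dvd)
  ultimately show ?thesis
    by (auto simp: nonmultiple_count_def Suc_diff_le)
qed (auto simp: nonmultiple_count_def)

lemma nonmultiple_count_mono: "a \<le> b \<Longrightarrow> nonmultiple_count m a \<le> nonmultiple_count m b"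
  by (rule lift_Suc_mono_le[of "nonmultiple_count m"]) (auto simp: nonmultiple_count_Suc)

text \<open>The count goes up by one exactly at a non-multiple, which separates such a
  \<open>d\<close> from everything below it; monotonicity gives the other direction.\<close>

lemma nonmultiple_count_less_iff:
  assumes "\<not> m dvd d"
  shows "nonmultiple_count m a < nonmultiple_count m d \<longleftrightarrow> a < d"
proof -
  obtain d' where d: "d = Suc d'"
    using assms by (cases d) auto
  show ?thesis
    using assms nonmultiple_count_mono[of a d' m] nonmultiple_count_mono[of d a m] by (cases "a < d") (auto simp: d nonmultiple_count_Suc)
qed

lemma nonmultiple_count_inj:
  assumes "\<not> m dvd d" "\<not> m dvd d'" "nonmultiple_count m d = nonmultiple_count m d'"
  shows "d = d'"
  using assms nonmultiple_count_less_iff by (metis linorder_neqE_nat less_irrefl)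

lemma card_nonmultiples:
  assumes "a \<le> b"
  shows "card {i. a < i \<and> i \<le> b \<and> \<not> m dvd i} = nonmultiple_count m b - nonmultiple_count m a"
  using assms
proof (induction b rule: dec_induct)
  case base
  have "{i. a < i \<and> i \<le> a \<and> \<not> m dvd i} = {}" by auto
  then show ?case by simp
next
  case (step n)
  have "{i. a < i \<and> i \<le> Suc n \<and> \<not> m dvd i} =
      (if m dvd Suc n then {} else {Suc n}) \<union> {i. a < i \<and> i \<le> n \<and> \<not> m dvd i}"
    using step.hyps by (auto simp: le_Suc_eq)
  moreover have "finite {i. a < i \<and> i \<le> n \<and> \<not> m dvd i}"
    by (rule finite_subset[of _ "{..n}"]) auto
  ultimately show ?case
    using step nonmultiple_count_mono[of a n m] by (auto simp: nonmultiple_count_Suc Suc_diff_le)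
qed

text \<open>As a difference of counts the signed distance needs no case split, and distances from a
  change point can be added.\<close>

lemma lambda2_eq_nonmultiple_count_diff:
  assumes "a \<le> N" "b \<le> N"
  shows "lambda2 m N a b = int (nonmultiple_count m b) - int (nonmultiple_count m a)"
proof -
  have "{i \<in> {1..N}. a < i \<and> i \<le> b \<and> \<not> m dvd i} = {i. a < i \<and> i \<le> b \<and> \<not> m dvd i}"
    "{i \<in> {1..N}. b < i \<and> i \<le> a \<and> \<not> m dvd i} = {i. b < i \<and> i \<le> a \<and> \<not> m dvd i}"
    using assms by auto
  then show ?thesis
    using card_nonmultiples[of a b m] card_nonmultiples[of b a m] nonmultiple_count_mono[of a b m] nonmultiple_count_mono[of b a m]
    by (auto simp: lambda2_def of_nat_diff)
qed

text \<open>The non-multiples form blocks of \<open>m - 1\<close> consecutive integers between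
  multiples of \<open>m\<close>: with \<open>n = (m - 1) * a + r\<close>, the one with index
  \<open>n\<close> is \<open>m * a + r + 1\<close>. The second hypothesis keeps \<open>nat\<close>
  and the subtraction of 1 from truncating.\<close>

lemma nonmultiple_at:
  assumes "m \<ge> 2" "int (nonmultiple_count m t) + k \<ge> 1"
  shows not_dvd_nonmultiple_at: "\<not> m dvd nonmultiple_at m t k"
    and nonmultiple_count_at: "int (nonmultiple_count m (nonmultiple_at m t k)) = int (nonmultiple_count m t) + k"
    and nonmultiple_at_ge_1: "nonmultiple_at m t k \<ge> 1"
proof -
  define n where "n = nat (int (nonmultiple_count m t) + k) - 1"
  define a r where "a = n div (m - 1)" and "r = n mod (m - 1)"
  have r: "r < m - 1" and n: "n = (m - 1) * a + r"
    using assms by (auto simp: a_def r_def)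
  have "(m - 1) * a + a = m * a"
    using assms by (cases m) auto
  then have p: "nonmultiple_at m t k = Suc r + m * a"
    unfolding nonmultiple_at_def Let_def n_def[symmetric] a_def[symmetric] by (subst n) simp
  have "Suc r < m"
    using r by simp
  then have "nonmultiple_at m t k mod m = Suc r" "nonmultiple_at m t k div m = a"
    unfolding p by (simp_all only: mod_mult_self2 div_mult_self2 mod_less div_less)
  then show "\<not> m dvd nonmultiple_at m t k" "nonmultiple_at m t k \<ge> 1"
    by (auto simp: dvd_eq_mod_eq_0 p)
  have "nonmultiple_count m (nonmultiple_at m t k) = n + 1"
    unfolding nonmultiple_count_def \<open>nonmultiple_at m t k div m = a\<close> unfolding p using \<open>(m - 1) * a + a = m * a\<close> n by linarith
  then show "int (nonmultiple_count m (nonmultiple_at m t k)) = int (nonmultiple_count m t) + k"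
    using assms by (simp add: n_def)
qed

lemma nonmultiple_at_count_diff:
  assumes "m \<ge> 2" "\<not> m dvd d"
  shows "nonmultiple_at m t (int (nonmultiple_count m d) - int (nonmultiple_count m t)) = d"
proof (rule nonmultiple_count_inj)
  have *: "int (nonmultiple_count m t) + (int (nonmultiple_count m d) - int (nonmultiple_count m t)) \<ge> 1"
    using nonmultiple_count_less_iff[OF assms(2), of 0] assms by (cases d) auto
  show "\<not> m dvd nonmultiple_at m t (int (nonmultiple_count m d) - int (nonmultiple_count m t))"
    using not_dvd_nonmultiple_at[OF assms(1) *] .
  show "nonmultiple_count m (nonmultiple_at m t (int (nonmultiple_count m d) - int (nonmultiple_count m t))) = nonmultiple_count m d"
    using nonmultiple_count_at[OF assms(1) *] by simp
qed fact

text \<open>This turns sums over the non-multiples in an interval into sums over an interval of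
  integers, the form in which the walks are written. The inverse is the signed distance from
  \<open>t\<close>.\<close>

lemma bij_betw_nonmultiple_at:
  assumes "m \<ge> 2"
  shows "bij_betw (nonmultiple_at m t) {int (nonmultiple_count m a) - int (nonmultiple_count m t)<..int (nonmultiple_count m b) - int (nonmultiple_count m t)}
           {i. a < i \<and> i \<le> b \<and> \<not> m dvd i}"
proof (rule bij_betwI[where g = "\<lambda>d. int (nonmultiple_count m d) - int (nonmultiple_count m t)"])
  show "nonmultiple_at m t \<in> {int (nonmultiple_count m a) - int (nonmultiple_count m t)<..int (nonmultiple_count m b) - int (nonmultiple_count m t)} \<rightarrow>
      {i. a < i \<and> i \<le> b \<and> \<not> m dvd i}"
  proof
    fix k assume k: "k \<in> {int (nonmultiple_count m a) - int (nonmultiple_count m t)<..int (nonmultiple_count m b) - int (nonmultiple_count m t)}"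
    then have "int (nonmultiple_count m t) + k \<ge> 1" by auto
    note p = not_dvd_nonmultiple_at[OF assms this] nonmultiple_count_at[OF assms this]
    show "nonmultiple_at m t k \<in> {i. a < i \<and> i \<le> b \<and> \<not> m dvd i}"
      using k p nonmultiple_count_less_iff[OF p(1), of a] nonmultiple_count_less_iff[OF p(1), of b] by auto
  qed
  show "(\<lambda>d. int (nonmultiple_count m d) - int (nonmultiple_count m t)) \<in> {i. a < i \<and> i \<le> b \<and> \<not> m dvd i} \<rightarrow>
      {int (nonmultiple_count m a) - int (nonmultiple_count m t)<..int (nonmultiple_count m b) - int (nonmultiple_count m t)}"
    by (auto simp: nonmultiple_count_less_iff intro!: nonmultiple_count_mono)
  show "int (nonmultiple_count m (nonmultiple_at m t k)) - int (nonmultiple_count m t) = k"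
    if "k \<in> {int (nonmultiple_count m a) - int (nonmultiple_count m t)<..int (nonmultiple_count m b) - int (nonmultiple_count m t)}" for k
    using that nonmultiple_count_at[OF assms, of t k] by auto
  show "nonmultiple_at m t (int (nonmultiple_count m d) - int (nonmultiple_count m t)) = d" if "d \<in> {i. a < i \<and> i \<le> b \<and> \<not> m dvd i}" for d
    using that nonmultiple_at_count_diff[OF assms] by auto
qed

text \<open>Of two consecutive integers at most one is a multiple of \<open>m \<ge> 2\<close>, so
  each pair contributes at least one non-multiple.\<close>

lemma nonmultiple_count_add_ge:
  assumes "m \<ge> 2"
  shows "nonmultiple_count m t + s \<le> nonmultiple_count m (t + 2 * s)"
proof (induction s)
  case (Suc s)
  have "\<not> (m dvd Suc (t + 2 * s) \<and> m dvd Suc (Suc (t + 2 * s)))"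
    using assms by (metis Suc_eq_plus1 dvd_add_right_iff nat_dvd_1_iff_1 numeral_le_one_iff semiring_norm(69))
  then show ?case
    using Suc by (auto simp: nonmultiple_count_Suc)
qed simp

text \<open>At least every other integer is a non-multiple, so a window of numbers is at most about
  twice as long in the integers, whatever \<open>m\<close> is.\<close>

lemma nonmultiple_at_close:
  assumes "m \<ge> 2" "\<bar>k\<bar> \<le> int R" "2 * R + 2 \<le> t"
  shows "int (nonmultiple_count m t) + k \<ge> 1" "nonmultiple_at m t k \<le> t + 2 * R" "t - (2 * R + 2) < nonmultiple_at m t k"
    "t < nonmultiple_at m t k \<longleftrightarrow> 0 < k"
proof -
  \<comment> \<open>The numbers from \<open>- R\<close> to 0 occupy \<open>R + 1\<close>
    non-multiples up to \<open>t\<close>, hence \<open>Suc R\<close> pairs on the left against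
    \<open>R\<close> on the right.\<close>
  define s where "s = t - (2 * R + 2)"
  have s: "t = s + 2 * Suc R"
    using assms by (simp add: s_def)
  have 1: "nonmultiple_count m s + Suc R \<le> nonmultiple_count m t"
    using nonmultiple_count_add_ge[OF assms(1), of s "Suc R"] s by simp
  show *: "int (nonmultiple_count m t) + k \<ge> 1"
    using 1 assms(2) by linarith
  note p = not_dvd_nonmultiple_at[OF assms(1) *] nonmultiple_count_at[OF assms(1) *]
  have "nonmultiple_count m t + R \<le> nonmultiple_count m (t + 2 * R)"
    by (rule nonmultiple_count_add_ge[OF assms(1)])
  then have "\<not> nonmultiple_count m (t + 2 * R) < nonmultiple_count m (nonmultiple_at m t k)"
    using p(2) assms(2) by linarith
  then show "nonmultiple_at m t k \<le> t + 2 * R"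
    using nonmultiple_count_less_iff[OF p(1)] by simp
  have "nonmultiple_count m s < nonmultiple_count m (nonmultiple_at m t k)"
    using 1 p(2) assms(2) by linarith
  then show "t - (2 * R + 2) < nonmultiple_at m t k"
    using nonmultiple_count_less_iff[OF p(1)] by (simp add: s_def)
  show "t < nonmultiple_at m t k \<longleftrightarrow> 0 < k"
    using nonmultiple_count_less_iff[OF p(1), of t] p(2) by auto
qed

section \<open>The second-stage criterion as a perturbed random walk\<close>

text \<open>The drift sits inside each summand and both sides read one noise sequence, so that the
  comparison with \<open>crit_walk\<close> goes summand by summand.\<close>

definition walk :: "real \<Rightarrow> (int \<Rightarrow> real) \<Rightarrow> int \<Rightarrow> real" where
  "walk a x k =
     (if 0 \<le> k then \<Sum>i\<in>{0<..k}. (a * x i + a\<^sup>2 / 2) else \<Sum>i\<in>{k<..0}. (a\<^sup>2 / 2 - a * x i))"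

lemma limit_process_eq_walk:
  "limit_process a l r k \<omega> = walk a (\<lambda>i. if 0 < i then r i \<omega> else l i \<omega>) k"
proof -
  have "{0<..k} = {1..k}" "{k<..0} = {k + 1..0}"
    by auto
  then show ?thesis
    by (auto simp: limit_process_def walk_def sum.distrib sum_subtractf sum_distrib_left sum_negf)
qed

text \<open>\<open>\<rho> * wobble R a x\<close> bounds the error in comparing two values of the walk in the window when
  the levels are only known up to \<open>\<rho> \<le> 1\<close>.\<close>

definition wobble :: "nat \<Rightarrow> real \<Rightarrow> (int \<Rightarrow> real) \<Rightarrow> real" where
  "wobble R a x = (\<Sum>i\<in>{- int R<..int R}. 4 * (\<bar>x i\<bar> + \<bar>a\<bar> + 1))"

text \<open>\<open>near_min\<close> and \<open>clear_min\<close> bracket the event that the second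
  stage picks number \<open>\<kappa>\<close>: the first is necessary for it, the second sufficient.
  For \<open>\<delta> = 0\<close> and \<open>\<kappa>\<close> in the window they say that
  \<open>\<kappa>\<close> is a minimiser, respectively the only minimiser, in the window.\<close>

definition near_min :: "nat \<Rightarrow> real \<Rightarrow> real \<Rightarrow> int \<Rightarrow> (int \<Rightarrow> real) \<Rightarrow> bool" where
  "near_min R \<delta> a \<kappa> x \<longleftrightarrow>
     (\<forall>k\<in>{- int R..int R}. walk a x \<kappa> \<le> walk a x k + \<delta> * wobble R a x)"

definition clear_min :: "nat \<Rightarrow> real \<Rightarrow> real \<Rightarrow> int \<Rightarrow> (int \<Rightarrow> real) \<Rightarrow> bool" where
  "clear_min R \<delta> a \<kappa> x \<longleftrightarrow>
     (\<forall>k\<in>{- int R..int R}. k \<noteq> \<kappa> \<longrightarrow> walk a x \<kappa> + \<delta> * wobble R a x < walk a x k)"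

text \<open>Half of the increment of the sum of squares when levels \<open>a\<close>,
  \<open>b\<close> are fitted to noise \<open>x\<close> around the true levels
  \<open>\<nu>l\<close>, \<open>\<nu>r\<close>. With exact levels it is
  \<open>walk (\<nu>r - \<nu>l) x\<close>.\<close>

definition crit_walk :: "real \<Rightarrow> real \<Rightarrow> real \<Rightarrow> real \<Rightarrow> (int \<Rightarrow> real) \<Rightarrow> int \<Rightarrow> real" where
  "crit_walk a b \<nu>l \<nu>r x k =
     (if 0 \<le> k then \<Sum>i\<in>{0<..k}. (b - a) * (x i + \<nu>r - (a + b) / 2)
      else \<Sum>i\<in>{k<..0}. (b - a) * ((a + b) / 2 - \<nu>l - x i))"

text \<open>The error is bounded summand by summand; \<open>\<rho> \<le> 1\<close> makes the terms
  quadratic in the level errors linear in \<open>\<rho>\<close>. Only half of \<open>wobble\<close>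
  is spent on one value, so that comparing two values costs one full \<open>wobble\<close>.\<close>

lemma crit_walk_close:
  assumes "\<bar>a - \<nu>l\<bar> \<le> \<rho>" "\<bar>b - \<nu>r\<bar> \<le> \<rho>" "\<rho> \<le> 1" "\<bar>k\<bar> \<le> int R"
  shows "\<bar>crit_walk a b \<nu>l \<nu>r x k - walk (\<nu>r - \<nu>l) x k\<bar> \<le> \<rho> * wobble R (\<nu>r - \<nu>l) x / 2"
proof -
  define \<Delta> where "\<Delta> = \<nu>r - \<nu>l"
  define h where "h i = 2 * \<rho> * (\<bar>x i\<bar> + \<bar>\<Delta>\<bar> + 1)" for i
  have "\<rho> \<ge> 0"
    using assms by linarith
  \<comment> \<open>This serves both sides of the walk: \<open>\<alpha>\<close> and
    \<open>\<beta>\<close> are the level errors, \<open>f\<close> is their mean, and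
    \<open>e\<close> is half the jump, with a plus sign on the right and a minus sign on the
    left.\<close>
  have *: "\<bar>(\<beta> - \<alpha>) * (z + e - (\<alpha> + \<beta>) / 2) - f * \<Delta>\<bar> \<le> 2 * \<rho> * (\<bar>z\<bar> + \<bar>\<Delta>\<bar> + 1)"
    if "\<bar>\<alpha>\<bar> \<le> \<rho>" "\<bar>\<beta>\<bar> \<le> \<rho>" "\<bar>e\<bar> = \<bar>\<Delta>\<bar> / 2" "\<bar>f\<bar> \<le> \<rho>" for z e \<alpha> \<beta> f
  proof -
    have "\<bar>(\<alpha> + \<beta>) / 2\<bar> \<le> 1"
      using that(1,2) assms(3) by (simp add: abs_le_iff)
    then have "\<bar>z + e - (\<alpha> + \<beta>) / 2\<bar> \<le> \<bar>z\<bar> + \<bar>\<Delta>\<bar> / 2 + 1"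
      using that(3) by linarith
    then have "\<bar>(\<beta> - \<alpha>) * (z + e - (\<alpha> + \<beta>) / 2)\<bar> \<le> (2 * \<rho>) * (\<bar>z\<bar> + \<bar>\<Delta>\<bar> / 2 + 1)"
      unfolding abs_mult using that \<open>\<rho> \<ge> 0\<close> by (intro mult_mono) auto
    moreover have "\<bar>f * \<Delta>\<bar> \<le> \<rho> * \<bar>\<Delta>\<bar>"
      unfolding abs_mult using that by (intro mult_right_mono) auto
    ultimately show ?thesis
      by (simp add: algebra_simps abs_le_iff)
  qed
  have r: "\<bar>(b - a) * (x i + \<nu>r - (a + b) / 2) - (\<Delta> * x i + \<Delta>\<^sup>2 / 2)\<bar> \<le> h i" for i
  proof -
    have "(b - a) * (x i + \<nu>r - (a + b) / 2) - (\<Delta> * x i + \<Delta>\<^sup>2 / 2) =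
      ((b - \<nu>r) - (a - \<nu>l)) * (x i + \<Delta> / 2 - ((a - \<nu>l) + (b - \<nu>r)) / 2)
        - ((a - \<nu>l) + (b - \<nu>r)) / 2 * \<Delta>"
      by (simp add: \<Delta>_def field_simps power2_eq_square)
    then show ?thesis
      using *[of "a - \<nu>l" "b - \<nu>r" "\<Delta> / 2" "((a - \<nu>l) + (b - \<nu>r)) / 2" "x i"] assms
      by (simp add: h_def)
  qed
  have l: "\<bar>(b - a) * ((a + b) / 2 - \<nu>l - x i) - (\<Delta>\<^sup>2 / 2 - \<Delta> * x i)\<bar> \<le> h i" for i
  proof -
    have "(b - a) * ((a + b) / 2 - \<nu>l - x i) - (\<Delta>\<^sup>2 / 2 - \<Delta> * x i) =
      - (((b - \<nu>r) - (a - \<nu>l)) * (x i + (- \<Delta> / 2) - ((a - \<nu>l) + (b - \<nu>r)) / 2)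
        - ((a - \<nu>l) + (b - \<nu>r)) / 2 * \<Delta>)"
      by (simp add: \<Delta>_def field_simps power2_eq_square)
    then show ?thesis
      unfolding h_def using *[of "a - \<nu>l" "b - \<nu>r" "- \<Delta> / 2" "((a - \<nu>l) + (b - \<nu>r)) / 2" "x i"] assms
      by (simp only: abs_minus_cancel) auto
  qed
  have h: "h i \<ge> 0" for i
    using \<open>\<rho> \<ge> 0\<close> by (simp add: h_def)
  have sumh: "sum h {- int R<..int R} = \<rho> * wobble R \<Delta> x / 2"
    unfolding wobble_def h_def sum_distrib_left sum_divide_distrib
    by (intro sum.cong refl) (simp add: field_simps)
  show ?thesis
  proof (cases "0 \<le> k")
    case True
    have "\<bar>crit_walk a b \<nu>l \<nu>r x k - walk \<Delta> x k\<bar> \<le> sum h {0<..k}"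
      using True r by (simp add: crit_walk_def walk_def sum_subtractf[symmetric] sum_abs[THEN order_trans] sum_mono)
    also have "\<dots> \<le> sum h {- int R<..int R}"
      using h assms by (intro sum_mono2) auto
    finally show ?thesis
      using sumh by (simp add: \<Delta>_def)
  next
    case False
    have "\<bar>crit_walk a b \<nu>l \<nu>r x k - walk \<Delta> x k\<bar> \<le> sum h {k<..0}"
      using False l by (simp add: crit_walk_def walk_def sum_subtractf[symmetric] sum_abs[THEN order_trans] sum_mono)
    also have "\<dots> \<le> sum h {- int R<..int R}"
      using h assms by (intro sum_mono2) auto
    finally show ?thesis
      using sumh by (simp add: \<Delta>_def)
  qed
qed

text \<open>Level errors of at most a quarter of the jump preserve the sign of the fitted jump and
  keep the fitted midpoint at least a quarter of the jump away from either true level. The drift per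
  step is therefore large enough for the two hypotheses on the noise sums.\<close>

lemma crit_walk_pos:
  assumes "\<bar>a - \<nu>l\<bar> \<le> \<rho>" "\<bar>b - \<nu>r\<bar> \<le> \<rho>" "\<rho> \<le> \<bar>\<nu>r - \<nu>l\<bar> / 4" "\<nu>l \<noteq> \<nu>r"
    and "k > 0 \<Longrightarrow> 0 < sgn (\<nu>r - \<nu>l) * (\<Sum>i\<in>{0<..k}. x i) + \<bar>\<nu>r - \<nu>l\<bar> / 4 * of_int k"
    and "k < 0 \<Longrightarrow> 0 < - sgn (\<nu>r - \<nu>l) * (\<Sum>i\<in>{k<..0}. x i) + \<bar>\<nu>r - \<nu>l\<bar> / 4 * of_int \<bar>k\<bar>"
    and "k \<noteq> 0"
  shows "0 < crit_walk a b \<nu>l \<nu>r x k"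
proof -
  define u where "u = sgn (\<nu>r - \<nu>l)"
  have u: "u = 1 \<and> \<nu>r > \<nu>l \<or> u = -1 \<and> \<nu>r < \<nu>l"
    using assms(4) by (auto simp: u_def sgn_if)
  have ge: "\<bar>\<nu>r - \<nu>l\<bar> / 4 \<le> u * (\<nu>r - (a + b) / 2)" "\<bar>\<nu>r - \<nu>l\<bar> / 4 \<le> u * ((a + b) / 2 - \<nu>l)"
  proof -
    have "\<bar>\<nu>r - \<nu>l\<bar> = u * (\<nu>r - \<nu>l)"
      using u by auto
    moreover have "\<bar>u * (a - \<nu>l)\<bar> \<le> \<rho>" "\<bar>u * (b - \<nu>r)\<bar> \<le> \<rho>"
      using u assms(1,2) by auto
    moreover have
      "u * (\<nu>r - (a + b) / 2) = (u * (\<nu>r - \<nu>l) - u * (a - \<nu>l) - u * (b - \<nu>r)) / 2"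
      "u * ((a + b) / 2 - \<nu>l) = (u * (\<nu>r - \<nu>l) + u * (a - \<nu>l) + u * (b - \<nu>r)) / 2"
      by (simp_all add: field_simps)
    moreover have "D / 4 \<le> (p - q - r) / 2" if "D = p" "\<bar>q\<bar> \<le> \<rho>" "\<bar>r\<bar> \<le> \<rho>" "\<rho> \<le> D / 4" for D p q r :: real
      using that by (simp add: abs_le_iff field_simps)
    moreover have "D / 4 \<le> (p + q + r) / 2" if "D = p" "\<bar>q\<bar> \<le> \<rho>" "\<bar>r\<bar> \<le> \<rho>" "\<rho> \<le> D / 4" for D p q r :: real
      using that by (simp add: abs_le_iff field_simps)
    ultimately show "\<bar>\<nu>r - \<nu>l\<bar> / 4 \<le> u * (\<nu>r - (a + b) / 2)"
      "\<bar>\<nu>r - \<nu>l\<bar> / 4 \<le> u * ((a + b) / 2 - \<nu>l)"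
      using assms(3) by metis+
  qed
  have ub: "u * (b - a) > 0"
    using u assms by auto
  have uu: "u * u = 1"
    using u by auto
  show ?thesis
  proof (cases "k > 0")
    case True
    have "\<bar>\<nu>r - \<nu>l\<bar> / 4 * of_int k \<le> u * (\<nu>r - (a + b) / 2) * of_int k"
      using ge True by (intro mult_right_mono) auto
    then have "0 < u * (\<Sum>i\<in>{0<..k}. x i) + u * (\<nu>r - (a + b) / 2) * of_int k"
      using assms(5)[OF True] unfolding u_def[symmetric] by linarith
    then have "0 < u * (b - a) * (u * (\<Sum>i\<in>{0<..k}. x i) + u * (\<nu>r - (a + b) / 2) * of_int k)"
      by (rule mult_pos_pos[OF ub])
    also have "\<dots> = (u * u) * (b - a) * ((\<Sum>i\<in>{0<..k}. x i) + (\<nu>r - (a + b) / 2) * of_int k)"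
      by (simp add: algebra_simps)
    also have "\<dots> = crit_walk a b \<nu>l \<nu>r x k"
      unfolding uu using True
      by (simp add: crit_walk_def sum_distrib_left[symmetric] sum.distrib sum_subtractf algebra_simps)
    finally show ?thesis .
  next
    case False
    have "\<bar>\<nu>r - \<nu>l\<bar> / 4 * of_int \<bar>k\<bar> \<le> u * ((a + b) / 2 - \<nu>l) * of_int \<bar>k\<bar>"
      using ge by (intro mult_right_mono) auto
    then have "0 < - u * (\<Sum>i\<in>{k<..0}. x i) + u * ((a + b) / 2 - \<nu>l) * of_int \<bar>k\<bar>"
      using assms(6) assms(7) False unfolding u_def[symmetric] by linarith
    then have "0 < u * (b - a) * (- u * (\<Sum>i\<in>{k<..0}. x i) + u * ((a + b) / 2 - \<nu>l) * of_int \<bar>k\<bar>)"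
      by (rule mult_pos_pos[OF ub])
    also have "\<dots> = (u * u) * (b - a) * (- (\<Sum>i\<in>{k<..0}. x i) + ((a + b) / 2 - \<nu>l) * of_int \<bar>k\<bar>)"
      by (simp add: algebra_simps)
    also have "\<dots> = crit_walk a b \<nu>l \<nu>r x k"
      unfolding uu using False assms(7)
      by (simp add: crit_walk_def sum_distrib_left[symmetric] sum.distrib sum_subtractf algebra_simps)
    finally show ?thesis .
  qed
qed

section \<open>Increments of the sum of squares and localization of its minimiser\<close>

definition crit :: "(nat \<Rightarrow> real) \<Rightarrow> nat set \<Rightarrow> real \<Rightarrow> real \<Rightarrow> nat \<Rightarrow> real" where
  "crit y S a b d = (\<Sum>j\<in>S. (y j - a * of_bool (j \<le> d) - b * of_bool (j > d))\<^sup>2)"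

text \<open>Moving the split from \<open>p\<close> to \<open>d\<close> changes the fitted level,
  from \<open>b\<close> to \<open>a\<close>, only for \<open>p < j \<le> d\<close>, and
  \<open>(y - a)^2 - (y - b)^2 = 2 * (b - a) * (y - (a + b) / 2)\<close>.\<close>

lemma crit_diff:
  assumes "finite S" "p \<le> d"
  shows "crit y S a b d - crit y S a b p = 2 * (\<Sum>j\<in>{j\<in>S. p < j \<and> j \<le> d}. (b - a) * (y j - (a + b) / 2))"
proof -
  have "crit y S a b d - crit y S a b p =
      (\<Sum>j\<in>S. if p < j \<and> j \<le> d then 2 * ((b - a) * (y j - (a + b) / 2)) else 0)"
    unfolding crit_def sum_subtractf[symmetric] using assms
    by (intro sum.cong refl) (auto simp: power2_eq_square field_simps)
  then show ?thesis
    unfolding sum_distrib_left using assms by (simp add: sum.inter_filter)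
qed

text \<open>Since \<open>t\<close> is within \<open>r\<close> of \<open>s\<close>, all non-multiples
  between \<open>t\<close> and a candidate \<open>d\<close> lie in the second-stage set, so none is
  missing from the sum. The reference point \<open>t\<close> may itself be a multiple of
  \<open>m\<close> and so need not be a candidate.\<close>

lemma crit_eq_crit_walk:
  assumes m: "m \<ge> 2" and t: "t \<in> {1..N}" "\<bar>real t - s\<bar> \<le> r"
    and yr: "\<And>i. i \<in> second_stage_set m N r s \<Longrightarrow> t < i \<Longrightarrow> y i = \<nu>r + e i"
    and yl: "\<And>i. i \<in> second_stage_set m N r s \<Longrightarrow> i \<le> t \<Longrightarrow> y i = \<nu>l + e i"
    and d: "d \<in> second_stage_set m N r s"
  shows "crit y (second_stage_set m N r s) a b d - crit y (second_stage_set m N r s) a b t =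
    2 * crit_walk a b \<nu>l \<nu>r (\<lambda>i. e (nonmultiple_at m t i)) (int (nonmultiple_count m d) - int (nonmultiple_count m t))"
proof -
  let ?S = "second_stage_set m N r s"
  let ?k = "int (nonmultiple_count m d) - int (nonmultiple_count m t)"
  have S: "finite ?S" "\<not> m dvd d"
    using d by (auto simp: second_stage_set_def)
  show ?thesis
  proof (cases "t < d")
    case True
    have *: "{j\<in>?S. t < j \<and> j \<le> d} = {i. t < i \<and> i \<le> d \<and> \<not> m dvd i}"
      using d t by (auto simp: second_stage_set_def)
    have "crit y ?S a b d - crit y ?S a b t
        = 2 * (\<Sum>j\<in>{j\<in>?S. t < j \<and> j \<le> d}. (b - a) * (y j - (a + b) / 2))"
      using True S by (intro crit_diff) auto
    also have "\<dots> = 2 * (\<Sum>j\<in>{j\<in>?S. t < j \<and> j \<le> d}. (b - a) * (e j + \<nu>r - (a + b) / 2))"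
      using yr by (auto intro!: sum.cong arg_cong[where f = "\<lambda>x. 2 * x"])
    also have "\<dots> = 2 * (\<Sum>i\<in>{0<..?k}. (b - a) * (e (nonmultiple_at m t i) + \<nu>r - (a + b) / 2))"
      unfolding * using sum.reindex_bij_betw[OF bij_betw_nonmultiple_at[OF m, of t t d],
          of "\<lambda>j. (b - a) * (e j + \<nu>r - (a + b) / 2)"] by simp
    also have "\<dots> = 2 * crit_walk a b \<nu>l \<nu>r (\<lambda>i. e (nonmultiple_at m t i)) ?k"
      using nonmultiple_count_mono[of t d m] True by (simp add: crit_walk_def)
    finally show ?thesis .
  next
    case False
    have *: "{j\<in>?S. d < j \<and> j \<le> t} = {i. d < i \<and> i \<le> t \<and> \<not> m dvd i}"
      using d t by (auto simp: second_stage_set_def)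
    have "crit y ?S a b t - crit y ?S a b d
        = 2 * (\<Sum>j\<in>{j\<in>?S. d < j \<and> j \<le> t}. (b - a) * (y j - (a + b) / 2))"
      using False S by (intro crit_diff) auto
    also have "\<dots> = - 2 * (\<Sum>j\<in>{j\<in>?S. d < j \<and> j \<le> t}. (b - a) * ((a + b) / 2 - \<nu>l - e j))"
      using yl by (auto simp: sum_distrib_left field_simps intro!: sum.cong)
    also have "\<dots> = - 2 * (\<Sum>i\<in>{?k<..0}. (b - a) * ((a + b) / 2 - \<nu>l - e (nonmultiple_at m t i)))"
      unfolding * using sum.reindex_bij_betw[OF bij_betw_nonmultiple_at[OF m, of t d t],
          of "\<lambda>j. (b - a) * ((a + b) / 2 - \<nu>l - e j)"] by simp
    also have "\<dots> = - 2 * crit_walk a b \<nu>l \<nu>r (\<lambda>i. e (nonmultiple_at m t i)) ?k"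
      using nonmultiple_count_mono[of d t m] False by (auto simp add: crit_walk_def)
    finally show ?thesis by simp
  qed
qed

text \<open>After division by \<open>\<bar>\<Delta>\<bar>\<close> the walk has drift \<open>\<bar>\<Delta>\<bar> / 2\<close> per step. Level errors of at most
  \<open>\<bar>\<Delta>\<bar> / 4\<close> leave a drift of \<open>\<bar>\<Delta>\<bar> / 4\<close>, which the noise must not outweigh.\<close>

definition tail_good :: "nat \<Rightarrow> nat \<Rightarrow> nat \<Rightarrow> nat \<Rightarrow> real \<Rightarrow> (nat \<Rightarrow> real) \<Rightarrow> bool" where
  "tail_good m N R t \<Delta> e \<longleftrightarrow>
     (\<forall>d\<in>{d\<in>{1..N}. \<not> m dvd d}. 
        (R < card {i. t < i \<and> i \<le> d \<and> \<not> m dvd i} \<longrightarrow>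
          0 < sgn \<Delta> * (\<Sum>i | t < i \<and> i \<le> d \<and> \<not> m dvd i. e i)
              + \<bar>\<Delta>\<bar> / 4 * real (card {i. t < i \<and> i \<le> d \<and> \<not> m dvd i})) \<and>
        (R < card {i. d < i \<and> i \<le> t \<and> \<not> m dvd i} \<longrightarrow>
          0 < - sgn \<Delta> * (\<Sum>i | d < i \<and> i \<le> t \<and> \<not> m dvd i. e i)
              + \<bar>\<Delta>\<bar> / 4 * real (card {i. d < i \<and> i \<le> t \<and> \<not> m dvd i})))"

text \<open>\<open>tail_good\<close> forces the minimiser into the window, because beyond it the
  criterion exceeds its value at number 0. Inside the window the criterion is the walk up to the
  error of \<open>crit_walk_close\<close>, so the chosen number is a near minimum, and a clear
  minimum leaves no other choice.\<close>

lemma second_stage_localization: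
  assumes m: "m \<ge> 2" and t: "t \<in> {1..N}" "\<bar>real t - s\<bar> \<le> w" and K: "K \<ge> 2"
    and R: "2 * R + 2 \<le> w" "2 * R + 2 \<le> t" "t + 2 * R \<le> N"
    and yr: "\<And>i. t < i \<Longrightarrow> i \<in> second_stage_set m N (of_int K * w) s \<Longrightarrow> y i = \<nu>r + e i"
    and yl: "\<And>i. i \<le> t \<Longrightarrow> i \<in> second_stage_set m N (of_int K * w) s \<Longrightarrow> y i = \<nu>l + e i"
    and ab: "\<bar>a - \<nu>l\<bar> \<le> \<rho>" "\<bar>b - \<nu>r\<bar> \<le> \<rho>" "\<rho> \<le> \<delta>" "\<delta> \<le> 1" "\<delta> \<le> \<bar>\<nu>r - \<nu>l\<bar> / 4" "\<nu>l \<noteq> \<nu>r"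
    and tail: "tail_good m N R t (\<nu>r - \<nu>l) e"
    and \<kappa>: "\<bar>\<kappa>\<bar> \<le> int R"
  defines "d \<equiv> second_stage_estimator y (second_stage_set m N (of_int K * w) s) a b"
  shows "lambda2 m N t d = \<kappa> \<Longrightarrow> near_min R \<delta> (\<nu>r - \<nu>l) \<kappa> (\<lambda>i. e (nonmultiple_at m t i))"
    and "clear_min R \<delta> (\<nu>r - \<nu>l) \<kappa> (\<lambda>i. e (nonmultiple_at m t i)) \<Longrightarrow> lambda2 m N t d = \<kappa>"
proof -
  let ?S = "second_stage_set m N (of_int K * w) s"
  let ?x = "\<lambda>i. e (nonmultiple_at m t i)"
  define k where "k = int (nonmultiple_count m d) - int (nonmultiple_count m t)"
  have w: "w \<ge> 0"
    using t(2) by linarith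
  \<comment> \<open>Radius \<open>K * w\<close> about the first-stage estimate \<open>s\<close>
    contains radius \<open>w\<close> about \<open>t\<close>; this is the use of
    \<open>K \<ge> 2\<close>.\<close>
  have "2 * w \<le> of_int K * w"
    using K w by (intro mult_right_mono) auto
  then have Kw: "\<bar>real t - s\<bar> \<le> of_int K * w" "w \<le> of_int K * w - w"
    using t(2) w by linarith+
  \<comment> \<open>Every number in the window belongs to a candidate, so the minimiser can be
    compared with all of them.\<close>
  have posS: "nonmultiple_at m t i \<in> ?S" if "\<bar>i\<bar> \<le> int R" for i
  proof -
    note p = nonmultiple_at_close[OF m that R(2)]
    have "nonmultiple_at m t i \<in> {1..N}"
      using p nonmultiple_at_ge_1[OF m p(1)] R(3) by auto
    moreover have "\<bar>real (nonmultiple_at m t i) - real t\<bar> \<le> w"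
      using p(2,3) R(1,2) by linarith
    ultimately show ?thesis
      using not_dvd_nonmultiple_at[OF m p(1)] t(2) Kw(2) by (auto simp: second_stage_set_def)
  qed
  have cntpos: "int (nonmultiple_count m (nonmultiple_at m t i)) - int (nonmultiple_count m t) = i" if "\<bar>i\<bar> \<le> int R" for i
    using nonmultiple_count_at[OF m nonmultiple_at_close(1)[OF m that R(2)]] by simp
  have finS: "finite ?S" "?S \<noteq> {}"
    using posS[of 0] by (auto simp: second_stage_set_def)
  have d: "d \<in> ?S" "\<And>d'. d' \<in> ?S \<Longrightarrow> crit y ?S a b d \<le> crit y ?S a b d'"
    using arg_min_if_finite(1)[OF finS, of "crit y ?S a b"] arg_min_least[OF finS, of _ "crit y ?S a b"]
    unfolding d_def second_stage_estimator_def crit_def by blast+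
  have cw: "crit y ?S a b d' - crit y ?S a b t =
      2 * crit_walk a b \<nu>l \<nu>r ?x (int (nonmultiple_count m d') - int (nonmultiple_count m t))" if "d' \<in> ?S" for d'
    by (rule crit_eq_crit_walk[OF m t(1) Kw(1) yr yl that])
  have le: "crit_walk a b \<nu>l \<nu>r ?x k \<le> crit_walk a b \<nu>l \<nu>r ?x i" if "\<bar>i\<bar> \<le> int R" for i
    using d(2)[OF posS[OF that]] cw[OF d(1)] cw[OF posS[OF that]] cntpos[OF that] by (simp add: k_def)
  have dm: "\<not> m dvd d" "d \<in> {1..N}"
    using d(1) by (auto simp: second_stage_set_def)
  have k: "\<bar>k\<bar> \<le> int R"
  proof (rule ccontr)
    assume "\<not> \<bar>k\<bar> \<le> int R"
    moreover have "0 < crit_walk a b \<nu>l \<nu>r ?x k" if k: "\<bar>k\<bar> > int R"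
    proof (rule crit_walk_pos[OF ab(1,2)])
      show "\<rho> \<le> \<bar>\<nu>r - \<nu>l\<bar> / 4" "\<nu>l \<noteq> \<nu>r" "k \<noteq> 0"
        using ab k by auto
      show "0 < sgn (\<nu>r - \<nu>l) * (\<Sum>i\<in>{0<..k}. ?x i) + \<bar>\<nu>r - \<nu>l\<bar> / 4 * of_int k" if "k > 0"
      proof -
        have "t < d"
          using that nonmultiple_count_less_iff[OF dm(1), of t] by (simp add: k_def)
        then have card: "int (card {i. t < i \<and> i \<le> d \<and> \<not> m dvd i}) = k"
          using that by (simp add: card_nonmultiples k_def of_nat_diff)
        have sum: "(\<Sum>i\<in>{0<..k}. ?x i) = (\<Sum>i | t < i \<and> i \<le> d \<and> \<not> m dvd i. e i)"
          unfolding k_def using sum.reindex_bij_betw[OF bij_betw_nonmultiple_at[OF m, of t t d], of e] by simp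
        have "R < card {i. t < i \<and> i \<le> d \<and> \<not> m dvd i}"
          using card k that by linarith
        then show ?thesis
          using tail dm sum card by (auto simp: tail_good_def)
      qed
      show "0 < - sgn (\<nu>r - \<nu>l) * (\<Sum>i\<in>{k<..0}. ?x i) + \<bar>\<nu>r - \<nu>l\<bar> / 4 * of_int \<bar>k\<bar>" if "k < 0"
      proof -
        have "d < t"
          using that nonmultiple_count_mono[of t d m] by (cases "t \<le> d") (auto simp: k_def)
        then have card: "int (card {i. d < i \<and> i \<le> t \<and> \<not> m dvd i}) = \<bar>k\<bar>"
          using that by (simp add: card_nonmultiples k_def of_nat_diff)
        have sum: "(\<Sum>i\<in>{k<..0}. ?x i) = (\<Sum>i | d < i \<and> i \<le> t \<and> \<not> m dvd i. e i)"
          unfolding k_def using sum.reindex_bij_betw[OF bij_betw_nonmultiple_at[OF m, of t d t], of e] by simp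
        have "R < card {i. d < i \<and> i \<le> t \<and> \<not> m dvd i}"
          using card k that by linarith
        moreover have "real (card {i. d < i \<and> i \<le> t \<and> \<not> m dvd i}) = of_int \<bar>k\<bar>"
          using arg_cong[OF card, of real_of_int] by simp
        ultimately show ?thesis
          using tail dm sum unfolding tail_good_def by auto
      qed
    qed
    ultimately show False
      using le[of 0] by (simp add: crit_walk_def)
  qed
  have \<rho>: "\<rho> \<le> 1"
    using ab by simp
  have wob: "\<rho> * wobble R (\<nu>r - \<nu>l) ?x \<le> \<delta> * wobble R (\<nu>r - \<nu>l) ?x"
    using ab by (intro mult_right_mono) (auto simp: wobble_def intro!: sum_nonneg)
  \<comment> \<open>\<open>crit_walk_close\<close> is applied at \<open>k\<close> and at
    \<open>i\<close>, at half of \<open>\<rho> * wobble\<close> each.\<close>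
  have wle: "walk (\<nu>r - \<nu>l) ?x k \<le> walk (\<nu>r - \<nu>l) ?x i + \<delta> * wobble R (\<nu>r - \<nu>l) ?x"
    if "\<bar>i\<bar> \<le> int R" for i
    using le[OF that] crit_walk_close[OF ab(1,2) \<rho> k, of ?x] crit_walk_close[OF ab(1,2) \<rho> that, of ?x] wob
    by linarith
  have lam: "lambda2 m N t d = k"
    using dm t by (simp add: lambda2_eq_nonmultiple_count_diff k_def)
  show "near_min R \<delta> (\<nu>r - \<nu>l) \<kappa> ?x" if "lambda2 m N t d = \<kappa>"
    using that wle lam by (auto simp: near_min_def)
  show "lambda2 m N t d = \<kappa>" if "clear_min R \<delta> (\<nu>r - \<nu>l) \<kappa> ?x"
  proof (rule ccontr)
    assume "lambda2 m N t d \<noteq> \<kappa>"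
    moreover have "k \<in> {- int R..int R}"
      using k by auto
    ultimately have "walk (\<nu>r - \<nu>l) ?x \<kappa> + \<delta> * wobble R (\<nu>r - \<nu>l) ?x < walk (\<nu>r - \<nu>l) ?x k"
      using that unfolding lam clear_min_def by blast
    then show False
      using wle[OF \<kappa>] by simp
  qed
qed

section \<open>Subgaussian tails and measurability of the second-stage estimator\<close>

text \<open>A Chernoff bound: independence factorizes the exponential moment of the sum, and
  subgaussianity bounds each factor.\<close>

lemma (in prob_space) subgaussian_sum_tail:
  assumes ind: "indep_vars (\<lambda>_. borel) X I" and A: "finite A" "A \<subseteq> I"
    and sub: "\<And>i. i \<in> A \<Longrightarrow> subgaussian M \<sigma> (X i)"
    and pos: "\<sigma> > 0" "c > 0" "\<bar>u\<bar> = 1"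
  shows "prob {\<omega> \<in> space M. u * (\<Sum>i\<in>A. X i \<omega>) + c * real (card A) \<le> 0}
           \<le> exp (- (c\<^sup>2 / (2 * \<sigma>\<^sup>2))) ^ card A"
proof -
  \<comment> \<open>This minimises the exponent per summand,
    \<open>l^2 * \<sigma>^2 / 2 - l * c\<close>, with value
    \<open>- c^2 / (2 * \<sigma>^2)\<close>.\<close>
  define l where "l = c / \<sigma>\<^sup>2"
  have l: "l > 0"
    using pos by (simp add: l_def)
  have u2: "u\<^sup>2 = 1"
    using pos(3) by (simp add: abs_square_eq_1)
  have indA: "indep_vars (\<lambda>_. borel) (\<lambda>i \<omega>. exp (- (l * u) * X i \<omega>)) A"
    by (rule indep_vars_compose2[OF indep_vars_subset[OF ind A(2)]]) simp
  have int1: "integrable M (\<lambda>\<omega>. exp (- (l * u) * X i \<omega>))" if "i \<in> A" for i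
    using sub[OF that] unfolding subgaussian_def by blast
  have subI: "(\<integral>\<omega>. exp (- (l * u) * X i \<omega>) \<partial>M) \<le> exp ((- (l * u))\<^sup>2 * \<sigma>\<^sup>2 / 2)" if "i \<in> A" for i
    using sub[OF that] unfolding subgaussian_def by blast
  have exp_sum_eq: "exp (l * (- u * (\<Sum>i\<in>A. X i \<omega>))) = (\<Prod>i\<in>A. exp (- (l * u) * X i \<omega>))" for \<omega>
    by (simp add: exp_sum[OF A(1), symmetric] sum_distrib_left sum_negf mult.assoc)
  have int: "integrable M (\<lambda>\<omega>. exp (l * (- u * (\<Sum>i\<in>A. X i \<omega>))))"
    unfolding exp_sum_eq by (rule indep_vars_integrable[OF A(1) indA int1])
  have "(\<integral>\<omega>. exp (l * (- u * (\<Sum>i\<in>A. X i \<omega>))) \<partial>M) = (\<Prod>i\<in>A. \<integral>\<omega>. exp (- (l * u) * X i \<omega>) \<partial>M)"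
    unfolding exp_sum_eq by (rule indep_vars_lebesgue_integral[OF A(1) indA int1])
  also have "\<dots> \<le> (\<Prod>i\<in>A. exp ((- (l * u))\<^sup>2 * \<sigma>\<^sup>2 / 2))"
    by (intro prod_mono conjI subI integral_nonneg_AE) simp_all
  also have "\<dots> = exp (real (card A) * ((- (l * u))\<^sup>2 * \<sigma>\<^sup>2 / 2))"
    unfolding prod_constant by (rule exp_of_nat_mult[symmetric])
  also have "\<dots> = exp (l\<^sup>2 * \<sigma>\<^sup>2 / 2 * real (card A))"
    by (simp add: power_mult_distrib u2)
  finally have le: "(\<integral>\<omega>. exp (l * (- u * (\<Sum>i\<in>A. X i \<omega>))) \<partial>M) \<le> exp (l\<^sup>2 * \<sigma>\<^sup>2 / 2 * real (card A))" .
  have setint: "set_integrable M (space M) (\<lambda>\<omega>. exp (l * (- u * (\<Sum>i\<in>A. X i \<omega>))))"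
    unfolding set_integrable_def using int
    by (rule Bochner_Integration.integrable_cong[THEN iffD1, OF refl, rotated]) simp
  have "{\<omega> \<in> space M. u * (\<Sum>i\<in>A. X i \<omega>) + c * real (card A) \<le> 0} =
      {\<omega> \<in> space M. - u * (\<Sum>i\<in>A. X i \<omega>) \<ge> c * real (card A)}"
    by auto
  also have "prob \<dots> \<le> exp (- l * (c * real (card A))) *
      (\<integral>\<omega>\<in>space M. exp (l * (- u * (\<Sum>i\<in>A. X i \<omega>))) \<partial>M)"
    using setint by (intro Chernoff_ineq_ge[OF l]) auto
  also have "\<dots> = exp (- l * (c * real (card A))) * (\<integral>\<omega>. exp (l * (- u * (\<Sum>i\<in>A. X i \<omega>))) \<partial>M)"
    using int by (simp add: set_integral_space)
  also have "\<dots> \<le> exp (- l * (c * real (card A))) * exp (l\<^sup>2 * \<sigma>\<^sup>2 / 2 * real (card A))"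
    using le by simp
  also have "\<dots> = exp (real (card A) * (- (c\<^sup>2 / (2 * \<sigma>\<^sup>2))))"
  proof -
    have "- l * (c * n) + l\<^sup>2 * \<sigma>\<^sup>2 / 2 * n = n * (- (c\<^sup>2 / (2 * \<sigma>\<^sup>2)))" for n
      using pos(1) by (simp add: l_def field_simps power2_eq_square)
    then show ?thesis
      by (simp only: exp_add[symmetric])
  qed
  also have "\<dots> = exp (- (c\<^sup>2 / (2 * \<sigma>\<^sup>2))) ^ card A"
    by (rule exp_of_nat_mult)
  finally show ?thesis .
qed

text \<open>Shifting the exponents by \<open>R\<close> maps \<open>F\<close> injectively into the
  naturals, so a geometric series dominates.\<close>

lemma sum_power_le_geometric_tail:
  fixes q :: real
  assumes q: "0 \<le> q" "q < 1" and F: "finite F" "\<And>n. n \<in> F \<Longrightarrow> R \<le> n"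
  shows "(\<Sum>n\<in>F. q ^ n) \<le> q ^ R / (1 - q)"
proof -
  have inj: "inj_on (\<lambda>n. n - R) F"
    using F(2) by (intro inj_onI) (metis le_add_diff_inverse)
  have "(\<Sum>n\<in>F. q ^ n) = (\<Sum>n\<in>F. q ^ R * q ^ (n - R))"
    using F(2) by (intro sum.cong refl) (simp add: power_add[symmetric])
  also have "\<dots> = q ^ R * (\<Sum>k\<in>(\<lambda>n. n - R) ` F. q ^ k)"
    by (simp add: sum.reindex[OF inj] sum_distrib_left)
  also have "\<dots> \<le> q ^ R * (\<Sum>k. q ^ k)"
    using q F by (intro mult_left_mono sum_le_suminf summable_geometric) auto
  also have "(\<Sum>k. q ^ k) = 1 / (1 - q)"
    using q by (intro suminf_geometric) auto
  finally show ?thesis by simp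
qed

text \<open>A union bound over \<open>D\<close>. Distinct cardinalities make the single bounds
  distinct powers of \<open>q\<close> from \<open>R\<close> on, so their sum is at most a geometric
  tail that does not depend on the size of \<open>D\<close>.\<close>

lemma (in prob_space) subgaussian_sums_tail:
  assumes ind: "indep_vars (\<lambda>_. borel) X I"
    and sub: "\<And>i. i \<in> I \<Longrightarrow> subgaussian M \<sigma> (X i)"
    and pos: "\<sigma> > 0" "c > 0" "\<bar>u\<bar> = 1"
    and D: "finite D" "\<And>d. d \<in> D \<Longrightarrow> finite (A d) \<and> A d \<subseteq> I \<and> R \<le> card (A d)"
      "inj_on (\<lambda>d. card (A d)) D"
  defines "q \<equiv> exp (- (c\<^sup>2 / (2 * \<sigma>\<^sup>2)))"
  shows "prob {\<omega> \<in> space M. \<exists>d\<in>D. u * (\<Sum>i\<in>A d. X i \<omega>) + c * real (card (A d)) \<le> 0} \<le> q ^ R / (1 - q)"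
proof -
  let ?E = "\<lambda>d. {\<omega> \<in> space M. u * (\<Sum>i\<in>A d. X i \<omega>) + c * real (card (A d)) \<le> 0}"
  have q: "0 \<le> q" "q < 1"
    using pos by (auto simp: q_def)
  have X: "X i \<in> borel_measurable M" if "i \<in> I" for i
    using ind that by (auto simp: indep_vars_def)
  have E: "?E d \<in> events" if "d \<in> D" for d
  proof -
    have "(\<lambda>\<omega>. \<Sum>i\<in>A d. X i \<omega>) \<in> borel_measurable M"
      using D(2)[OF that] X by (intro borel_measurable_sum) auto
    then show ?thesis by measurable
  qed
  have "{\<omega> \<in> space M. \<exists>d\<in>D. u * (\<Sum>i\<in>A d. X i \<omega>) + c * real (card (A d)) \<le> 0} = (\<Union>d\<in>D. ?E d)"
    by auto
  also have "prob \<dots> \<le> (\<Sum>d\<in>D. prob (?E d))"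
    using D E by (intro finite_measure_subadditive_finite) auto
  also have "\<dots> \<le> (\<Sum>d\<in>D. q ^ card (A d))"
    unfolding q_def using D sub by (intro sum_mono subgaussian_sum_tail[OF ind] pos) auto
  also have "\<dots> = (\<Sum>n\<in>(\<lambda>d. card (A d)) ` D. q ^ n)"
    by (simp add: sum.reindex[OF D(3)])
  also have "\<dots> \<le> q ^ R / (1 - q)"
    using D by (intro sum_power_le_geometric_tail q) auto
  finally show ?thesis .
qed

text \<open>The bound involves neither \<open>N\<close> nor \<open>m\<close>, which allows
  \<open>R\<close> to be fixed before \<open>N\<close> grows. It is a union bound for each side of
  \<open>t\<close>.\<close>

lemma (in prob_space) tail_good_prob:
  assumes ind: "indep_vars (\<lambda>_. borel) X {1..N}"
    and sub: "\<And>i. i \<in> {1..N} \<Longrightarrow> subgaussian M \<sigma> (X i)"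
    and \<sigma>: "\<sigma> > 0" and \<Delta>: "\<Delta> \<noteq> 0" and t: "t \<le> N"
  defines "q \<equiv> exp (- ((\<bar>\<Delta>\<bar> / 4)\<^sup>2 / (2 * \<sigma>\<^sup>2)))"
  shows "{\<omega> \<in> space M. \<not> tail_good m N R t \<Delta> (\<lambda>i. X i \<omega>)} \<in> events" (is "?E \<in> _")
    and "prob {\<omega> \<in> space M. \<not> tail_good m N R t \<Delta> (\<lambda>i. X i \<omega>)} \<le> 2 * (q ^ R / (1 - q))"
proof -
  define A where "A d = {i. t < i \<and> i \<le> d \<and> \<not> m dvd i}" for d
  define B where "B d = {i. d < i \<and> i \<le> t \<and> \<not> m dvd i}" for d
  define DA where "DA = {d\<in>{1..N}. \<not> m dvd d \<and> R < card (A d)}"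
  define DB where "DB = {d\<in>{1..N}. \<not> m dvd d \<and> R < card (B d)}"
  have AB: "finite (A d)" "finite (B d)" "B d \<subseteq> {1..N}" "d \<le> N \<Longrightarrow> A d \<subseteq> {1..N}" for d
    unfolding A_def B_def using t by (auto intro: finite_subset[of _ "{..d}"] finite_subset[of _ "{..t}"])
  have X: "X i \<in> borel_measurable M" if "i \<in> {1..N}" for i
    using ind that by (auto simp: indep_vars_def)
  let ?EA = "{\<omega> \<in> space M. \<exists>d\<in>DA. sgn \<Delta> * (\<Sum>i\<in>A d. X i \<omega>) + \<bar>\<Delta>\<bar> / 4 * real (card (A d)) \<le> 0}"
  let ?EB = "{\<omega> \<in> space M. \<exists>d\<in>DB. - sgn \<Delta> * (\<Sum>i\<in>B d. X i \<omega>) + \<bar>\<Delta>\<bar> / 4 * real (card (B d)) \<le> 0}"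
  have E: "?E = ?EA \<union> ?EB"
    unfolding tail_good_def A_def[symmetric] B_def[symmetric] by (auto simp: DA_def DB_def not_less)
  have "(\<lambda>\<omega>. \<Sum>i\<in>A d. X i \<omega>) \<in> borel_measurable M" if "d \<in> DA" for d
    using AB(4)[of d] that by (intro borel_measurable_sum X) (auto simp: DA_def)
  moreover have "finite DA" "finite DB"
    by (auto simp: DA_def DB_def)
  ultimately have EA: "?EA \<in> events"
    by (intro sets.sets_Collect_finite_Ex) auto
  have "(\<lambda>\<omega>. \<Sum>i\<in>B d. X i \<omega>) \<in> borel_measurable M" for d
    using AB(3)[of d] by (intro borel_measurable_sum X) auto
  then have EB: "?EB \<in> events"
    using \<open>finite DB\<close> by (intro sets.sets_Collect_finite_Ex) auto
  show "?E \<in> events"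
    unfolding E using EA EB by auto
  \<comment> \<open>A set with more than \<open>R\<close> elements is non-empty, so \<open>d\<close>
    lies to the right of \<open>t\<close> and the truncated difference of counts is exact.\<close>
  have cA: "t < d \<and> card (A d) = nonmultiple_count m d - nonmultiple_count m t \<and> nonmultiple_count m t < nonmultiple_count m d" if "d \<in> DA" for d
  proof -
    have "t < d"
    proof (rule ccontr)
      assume "\<not> t < d"
      then have "A d = {}"
        by (auto simp: A_def)
      then show False
        using that by (simp add: DA_def)
    qed
    then show ?thesis
      using that by (auto simp: DA_def A_def card_nonmultiples nonmultiple_count_less_iff)
  qed
  have cB: "card (B d) = nonmultiple_count m t - nonmultiple_count m d \<and> nonmultiple_count m d < nonmultiple_count m t" if "d \<in> DB" for d
  proof -
    have "d < t"
    proof (rule ccontr)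
      assume "\<not> d < t"
      then have "B d = {}"
        by (auto simp: B_def)
      then show False
        using that by (simp add: DB_def)
    qed
    then have "card (B d) = nonmultiple_count m t - nonmultiple_count m d"
      by (simp add: B_def card_nonmultiples)
    then show ?thesis
      using that by (auto simp: DB_def)
  qed
  \<comment> \<open>A non-multiple is determined by its count, so different end points give
    different numbers of summands.\<close>
  have injA: "inj_on (\<lambda>d. card (A d)) DA"
  proof
    fix d d' assume *: "d \<in> DA" "d' \<in> DA" "card (A d) = card (A d')"
    then have "nonmultiple_count m d = nonmultiple_count m d'"
      using cA[OF *(1)] cA[OF *(2)] *(3) by linarith
    then show "d = d'"
      using *(1,2) nonmultiple_count_inj[of m d d'] by (auto simp: DA_def)
  qed
  have injB: "inj_on (\<lambda>d. card (B d)) DB"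
  proof
    fix d d' assume *: "d \<in> DB" "d' \<in> DB" "card (B d) = card (B d')"
    then have "nonmultiple_count m d = nonmultiple_count m d'"
      using cB[OF *(1)] cB[OF *(2)] *(3) by linarith
    then show "d = d'"
      using *(1,2) nonmultiple_count_inj[of m d d'] by (auto simp: DB_def)
  qed
  have "prob ?EA \<le> q ^ R / (1 - q)"
    unfolding q_def using \<Delta> AB injA
    by (intro subgaussian_sums_tail[OF ind sub \<sigma>]) (auto simp: DA_def abs_sgn_eq)
  moreover have "prob ?EB \<le> q ^ R / (1 - q)"
    unfolding q_def using \<Delta> AB injB
    by (intro subgaussian_sums_tail[OF ind sub \<sigma>]) (auto simp: DB_def abs_sgn_eq)
  moreover have "prob (?EA \<union> ?EB) \<le> prob ?EA + prob ?EB"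
    using EA EB by (intro measure_Un_le)
  ultimately show "prob ?E \<le> 2 * (q ^ R / (1 - q))"
    unfolding E by linarith
qed

text \<open>The estimator depends on the sample point only through the set \<open>B\<close> of all
  minimisers, which has finitely many possible values. Whatever \<open>SOME\<close> picks, on an
  empty set too, the result is a function of \<open>B\<close>, so measurability of \<open>B\<close>
  suffices.\<close>

lemma second_stage_estimator_measurable:
  assumes Y: "\<And>j. j \<in> {1..N} \<Longrightarrow> Y j \<in> borel_measurable M"
    and [measurable]: "t \<in> borel_measurable M" "a \<in> borel_measurable M" "b \<in> borel_measurable M"
  shows "(\<lambda>\<omega>. second_stage_estimator (\<lambda>j. Y j \<omega>) (second_stage_set m N r (t \<omega>)) (a \<omega>) (b \<omega>))
           \<in> measurable M (count_space UNIV)"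
proof -
  define S where "S \<omega> = second_stage_set m N r (t \<omega>)" for \<omega>
  define f where "f \<omega> = crit (\<lambda>j. Y j \<omega>) (S \<omega>) (a \<omega>) (b \<omega>)" for \<omega>
  define B where "B \<omega> = {d \<in> {1..N}. d \<in> S \<omega> \<and> (\<forall>d'\<in>{1..N}. d' \<in> S \<omega> \<longrightarrow> f \<omega> d \<le> f \<omega> d')}" for \<omega>
  have SN: "S \<omega> \<subseteq> {1..N}" for \<omega>
    by (auto simp: S_def second_stage_set_def)
  have "second_stage_estimator (\<lambda>j. Y j \<omega>) (S \<omega>) (a \<omega>) (b \<omega>) = (SOME d. d \<in> B \<omega>)" for \<omega>
  proof -
    have "is_arg_min (f \<omega>) (\<lambda>d. d \<in> S \<omega>) = (\<lambda>d. d \<in> B \<omega>)"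
      using SN[of \<omega>] by (force simp: is_arg_min_def B_def not_less fun_eq_iff)
    then show ?thesis
      unfolding second_stage_estimator_def arg_min_on_def arg_min_def
      by (simp add: f_def crit_def[abs_def])
  qed
  moreover have "B \<in> measurable M (count_space (Pow {1..N}))"
  proof (subst measurable_count_space_eq2, simp, intro conjI ballI)
    show "B \<in> space M \<rightarrow> Pow {1..N}"
      by (auto simp: B_def)
    have S_meas[measurable]: "Measurable.pred M (\<lambda>\<omega>. j \<in> S \<omega>)" for j
      unfolding S_def second_stage_set_def by measurable
    have [measurable]: "(\<lambda>\<omega>. f \<omega> d) \<in> borel_measurable M" for d
    proof -
      have "f \<omega> d = (\<Sum>j\<in>{1..N}. if j \<in> S \<omega>
          then (Y j \<omega> - a \<omega> * of_bool (j \<le> d) - b \<omega> * of_bool (j > d))\<^sup>2 else 0)" for \<omega>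
        unfolding f_def crit_def using SN[of \<omega>]
        by (simp add: sum.inter_restrict[symmetric] Int_absorb1)
      moreover have "(\<lambda>\<omega>. \<Sum>j\<in>{1..N}. if j \<in> S \<omega>
          then (Y j \<omega> - a \<omega> * of_bool (j \<le> d) - b \<omega> * of_bool (j > d))\<^sup>2 else 0) \<in> borel_measurable M"
      proof (intro borel_measurable_sum)
        fix j assume "j \<in> {1..N}"
        note [measurable] = Y[OF this]
        show "(\<lambda>\<omega>. if j \<in> S \<omega>
          then (Y j \<omega> - a \<omega> * of_bool (j \<le> d) - b \<omega> * of_bool (j > d))\<^sup>2 else 0) \<in> borel_measurable M"
          by measurable
      qed
      ultimately show ?thesis by simp
    qed
    fix D assume "D \<in> Pow {1..N}"
    then have D: "B \<omega> = D \<longleftrightarrow> (\<forall>d\<in>{1..N}. d \<in> D \<longleftrightarrow> d \<in> B \<omega>)" for \<omega>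
      unfolding B_def by blast
    have "B -` {D} \<inter> space M = {\<omega> \<in> space M. B \<omega> = D}"
      by auto
    also have "\<dots> = {\<omega> \<in> space M. \<forall>d\<in>{1..N}. d \<in> D \<longleftrightarrow>
        d \<in> S \<omega> \<and> (\<forall>d'\<in>{1..N}. d' \<in> S \<omega> \<longrightarrow> f \<omega> d \<le> f \<omega> d')}"
      unfolding D by (intro Collect_cong conj_cong refl ball_cong) (simp add: B_def)
    also have "\<dots> \<in> sets M"
      by measurable
    finally show "B -` {D} \<inter> space M \<in> sets M" .
  qed
  then have "(\<lambda>\<omega>. SOME d. d \<in> B \<omega>) \<in> measurable M (count_space UNIV)"
    by (rule measurable_compose) (simp add: measurable_count_space_eq1)
  ultimately show ?thesis
    unfolding S_def by simp
qed

lemma statistic_of_measurable: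
  assumes "statistic_of M I Y S T" "\<And>i. i \<in> I \<Longrightarrow> Y i \<in> borel_measurable M"
  shows "T \<in> measurable M S"
proof -
  obtain g where g: "g \<in> measurable (PiM I (\<lambda>_. borel)) S" "\<And>\<omega>. \<omega> \<in> space M \<Longrightarrow> T \<omega> = g (\<lambda>i\<in>I. Y i \<omega>)"
    using assms(1) unfolding statistic_of_def by blast
  have "(\<lambda>\<omega>. g (\<lambda>i\<in>I. Y i \<omega>)) \<in> measurable M S"
    by (rule measurable_compose[OF measurable_restrict g(1)]) (rule assms(2))
  then show ?thesis
    using g(2) by (subst measurable_cong[of M T "\<lambda>\<omega>. g (\<lambda>i\<in>I. Y i \<omega>)"]) auto
qed

section \<open>Independence and the law of a window\<close>

text \<open>Independence concerns finite subfamilies, and injectivity of \<open>f\<close> turns a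
  product over \<open>J\<close> into one over its image. This lets the noise be indexed by pairs of
  a change point and a number.\<close>

lemma (in prob_space) indep_vars_reindex:
  assumes ind: "indep_vars N X (f ` I)" and f: "inj_on f I"
  shows "indep_vars (\<lambda>i. N (f i)) (\<lambda>i. X (f i)) I"
  unfolding indep_vars_def2
proof (intro conjI ballI)
  show "random_variable (N (f i)) (X (f i))" if "i \<in> I" for i
    using ind that by (auto simp: indep_vars_def2)
  have sets: "indep_sets (\<lambda>k. {X k -` A \<inter> space M | A. A \<in> sets (N k)}) (f ` I)"
    using ind by (simp add: indep_vars_def2)
  show "indep_sets (\<lambda>i. {X (f i) -` A \<inter> space M | A. A \<in> sets (N (f i))}) I"
  proof (rule indep_setsI)
    show "{X (f i) -` A \<inter> space M | A. A \<in> sets (N (f i))} \<subseteq> events" if "i \<in> I" for i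
      using sets that unfolding indep_sets_def by auto
    fix A J assume J: "J \<noteq> {}" "J \<subseteq> I" "finite J"
      and A: "\<forall>j\<in>J. A j \<in> {X (f j) -` B \<inter> space M | B. B \<in> sets (N (f j))}"
    define g where "g = inv_into I f"
    have g: "g (f j) = j" if "j \<in> J" for j
      using f J that by (auto simp: g_def)
    have "prob (\<Inter>k\<in>f ` J. A (g k)) = (\<Prod>k\<in>f ` J. prob (A (g k)))"
      using A J g by (intro indep_setsD[OF sets]) auto
    moreover have "(\<Inter>k\<in>f ` J. A (g k)) = (\<Inter>j\<in>J. A j)"
      using g by auto
    moreover have "(\<Prod>k\<in>f ` J. prob (A (g k))) = (\<Prod>j\<in>J. prob (A j))"
      using g inj_on_subset[OF f J(2)] by (simp add: prod.reindex)
    ultimately show "prob (\<Inter>j\<in>J. A j) = (\<Prod>j\<in>J. prob (A j))"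
      by simp
  qed
qed

text \<open>Independence makes the joint law the product of the marginals, so equal marginals give
  equal joint laws.\<close>

lemma prob_eq_of_same_marginals:
  assumes "prob_space M" "prob_space P"
    and "prob_space.indep_vars M (\<lambda>_. S) X I" "prob_space.indep_vars P (\<lambda>_. S) X' I"
    and marg: "\<And>i. i \<in> I \<Longrightarrow> distr M S (X i) = distr P S (X' i)"
    and Q: "Measurable.pred (PiM I (\<lambda>_. S)) Q"
  shows "measure M {\<omega> \<in> space M. Q (\<lambda>i\<in>I. X i \<omega>)} = measure P {\<omega> \<in> space P. Q (\<lambda>i\<in>I. X' i \<omega>)}"
\<comment> \<open>Without coordinates there is only one restricted function, and both probabilities
  are 0 or both are 1; the product criterion used below is for non-empty index sets.\<close>
proof (cases "I = {}")
  case True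
  then show ?thesis
    using prob_space.prob_space[OF assms(1)] prob_space.prob_space[OF assms(2)]
    by (cases "Q (\<lambda>_. undefined)") (auto simp: restrict_def)
next
  case False
  interpret M: prob_space M by fact
  interpret P: prob_space P by fact
  have X: "\<And>i. i \<in> I \<Longrightarrow> X i \<in> measurable M S" "\<And>i. i \<in> I \<Longrightarrow> X' i \<in> measurable P S"
    using assms(3,4) by (auto simp: M.indep_vars_def P.indep_vars_def)
  have "distr M (PiM I (\<lambda>_. S)) (\<lambda>\<omega>. \<lambda>i\<in>I. X i \<omega>) = PiM I (\<lambda>i. distr M S (X i))"
    using M.indep_vars_iff_distr_eq_PiM'[OF False X(1)] assms(3) by simp
  also have "\<dots> = PiM I (\<lambda>i. distr P S (X' i))"
    using marg by (intro PiM_cong) auto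
  also have "\<dots> = distr P (PiM I (\<lambda>_. S)) (\<lambda>\<omega>. \<lambda>i\<in>I. X' i \<omega>)"
    using P.indep_vars_iff_distr_eq_PiM'[OF False X(2)] assms(4) by simp
  finally have *: "distr M (PiM I (\<lambda>_. S)) (\<lambda>\<omega>. \<lambda>i\<in>I. X i \<omega>) =
    distr P (PiM I (\<lambda>_. S)) (\<lambda>\<omega>. \<lambda>i\<in>I. X' i \<omega>)" .
  define B where "B = {y \<in> space (PiM I (\<lambda>_. S)). Q y}"
  have B: "B \<in> sets (PiM I (\<lambda>_. S))"
    using Q unfolding B_def by measurable
  have rM: "(\<lambda>\<omega>. \<lambda>i\<in>I. X i \<omega>) \<in> measurable M (PiM I (\<lambda>_. S))"
    and rP: "(\<lambda>\<omega>. \<lambda>i\<in>I. X' i \<omega>) \<in> measurable P (PiM I (\<lambda>_. S))"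
    using X by (auto intro: measurable_restrict)
  have "{\<omega> \<in> space M. Q (\<lambda>i\<in>I. X i \<omega>)} = (\<lambda>\<omega>. \<lambda>i\<in>I. X i \<omega>) -` B \<inter> space M"
    using measurable_space[OF rM] by (auto simp: B_def)
  moreover have "{\<omega> \<in> space P. Q (\<lambda>i\<in>I. X' i \<omega>)} = (\<lambda>\<omega>. \<lambda>i\<in>I. X' i \<omega>) -` B \<inter> space P"
    using measurable_space[OF rP] by (auto simp: B_def)
  ultimately show ?thesis
    using measure_distr[OF rM B] measure_distr[OF rP B] * by simp
qed

section \<open>Window events: locality, measurability and dependence on the margin\<close>

lemma walk_cong:
  assumes "\<And>i. \<bar>i\<bar> \<le> \<bar>k\<bar> \<Longrightarrow> x i = y i"
  shows "walk a x k = walk a y k"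
  using assms by (auto simp: walk_def intro!: sum.cong)

lemma wobble_cong:
  assumes "\<And>i. \<bar>i\<bar> \<le> int R \<Longrightarrow> x i = y i"
  shows "wobble R a x = wobble R a y"
  using assms by (auto simp: wobble_def intro!: sum.cong)

lemma near_min_clear_min_cong:
  assumes "\<And>i. \<bar>i\<bar> \<le> int R \<Longrightarrow> x i = y i" "\<bar>\<kappa>\<bar> \<le> int R"
  shows "near_min R \<delta> a \<kappa> x = near_min R \<delta> a \<kappa> y" "clear_min R \<delta> a \<kappa> x = clear_min R \<delta> a \<kappa> y"
proof -
  have "walk a x k = walk a y k" if "k \<in> {- int R..int R}" for k
    using that by (intro walk_cong assms(1)) auto
  moreover have "walk a x \<kappa> = walk a y \<kappa>"
    using assms(2) by (intro walk_cong assms(1)) auto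
  moreover have "wobble R a x = wobble R a y"
    by (intro wobble_cong assms(1))
  ultimately show "near_min R \<delta> a \<kappa> x = near_min R \<delta> a \<kappa> y" "clear_min R \<delta> a \<kappa> x = clear_min R \<delta> a \<kappa> y"
    unfolding near_min_def clear_min_def by auto
qed

lemma walk_measurable:
  assumes "\<And>i. \<bar>i\<bar> \<le> \<bar>k\<bar> \<Longrightarrow> X i \<in> borel_measurable M"
  shows "(\<lambda>\<omega>. walk a (\<lambda>i. X i \<omega>) k) \<in> borel_measurable M"
proof (cases "0 \<le> k")
  case True
  then show ?thesis
    unfolding walk_def using assms
    by (auto intro!: borel_measurable_sum borel_measurable_add borel_measurable_times)
next
  case False
  then show ?thesis
    unfolding walk_def using assms
    by (auto intro!: borel_measurable_sum borel_measurable_diff borel_measurable_times)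
qed

lemma near_min_clear_min_measurable:
  assumes X: "\<And>i. \<bar>i\<bar> \<le> int R \<Longrightarrow> X i \<in> borel_measurable M" and \<kappa>: "\<bar>\<kappa>\<bar> \<le> int R"
  shows "Measurable.pred M (\<lambda>\<omega>. near_min R \<delta> a \<kappa> (\<lambda>i. X i \<omega>))"
    and "Measurable.pred M (\<lambda>\<omega>. clear_min R \<delta> a \<kappa> (\<lambda>i. X i \<omega>))"
proof -
  have w: "(\<lambda>\<omega>. walk a (\<lambda>i. X i \<omega>) k) \<in> borel_measurable M" if "k \<in> {- int R..int R}" for k
    using that by (intro walk_measurable X) auto
  have [measurable]: "(\<lambda>\<omega>. walk a (\<lambda>i. X i \<omega>) \<kappa>) \<in> borel_measurable M"
    using \<kappa> by (intro w) auto
  have [measurable]: "(\<lambda>\<omega>. wobble R a (\<lambda>i. X i \<omega>)) \<in> borel_measurable M"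
    unfolding wobble_def using X
    by (intro borel_measurable_sum borel_measurable_times borel_measurable_add borel_measurable_abs borel_measurable_const) auto
  show "Measurable.pred M (\<lambda>\<omega>. near_min R \<delta> a \<kappa> (\<lambda>i. X i \<omega>))"
    unfolding near_min_def
  proof (intro pred_intros_finite)
    fix k assume "k \<in> {- int R..int R}"
    note [measurable] = w[OF this]
    show "Measurable.pred M (\<lambda>\<omega>. walk a (\<lambda>i. X i \<omega>) \<kappa> \<le> walk a (\<lambda>i. X i \<omega>) k + \<delta> * wobble R a (\<lambda>i. X i \<omega>))"
      by measurable
  qed simp
  show "Measurable.pred M (\<lambda>\<omega>. clear_min R \<delta> a \<kappa> (\<lambda>i. X i \<omega>))"
    unfolding clear_min_def
  proof (intro pred_intros_finite)
    fix k assume "k \<in> {- int R..int R}"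
    note [measurable] = w[OF this]
    show "Measurable.pred M (\<lambda>\<omega>. k \<noteq> \<kappa> \<longrightarrow> walk a (\<lambda>i. X i \<omega>) \<kappa> + \<delta> * wobble R a (\<lambda>i. X i \<omega>) < walk a (\<lambda>i. X i \<omega>) k)"
      by measurable
  qed simp
qed

lemma wobble_nonneg: "0 \<le> wobble R a x"
  by (auto simp: wobble_def intro!: sum_nonneg)

text \<open>\<open>wobble\<close> grows with \<open>R\<close>, so shrinking the window also shrinks
  the allowed slack; the last hypothesis permits this only where the slack is 0.\<close>

lemma near_min_antimono:
  assumes "near_min R \<delta> a \<kappa> x" "R' \<le> R" "\<delta> \<le> \<delta>'" "R' = R \<or> \<delta> = 0"
  shows "near_min R' \<delta>' a \<kappa> x"
proof -
  have "\<delta> * wobble R a x \<le> \<delta>' * wobble R' a x"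
    using assms(3,4) by (auto intro!: mult_right_mono wobble_nonneg mult_nonneg_nonneg)
  moreover have "walk a x \<kappa> \<le> walk a x k + \<delta> * wobble R a x" if "k \<in> {- int R'..int R'}" for k
    using assms(1,2) that by (auto simp: near_min_def)
  ultimately show ?thesis
    unfolding near_min_def by fastforce
qed

lemma clear_min_mono:
  assumes "clear_min R \<delta> a \<kappa> x" "\<delta>' \<le> \<delta>"
  shows "clear_min R \<delta>' a \<kappa> x"
  using assms(1) mult_right_mono[OF assms(2) wobble_nonneg[of R a x]]
  unfolding clear_min_def by (meson add_left_mono le_less_trans)

lemma near_min_iff_inverse:
  "near_min R 0 a \<kappa> x \<longleftrightarrow> (\<forall>n. near_min R (1 / real (Suc n)) a \<kappa> x)"
proof
  assume *: "\<forall>n. near_min R (1 / real (Suc n)) a \<kappa> x"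
  have "walk a x \<kappa> \<le> walk a x k + 0 * wobble R a x" if "k \<in> {- int R..int R}" for k
  proof (rule LIMSEQ_le_const)
    show "(\<lambda>n. walk a x k + 1 / real (Suc n) * wobble R a x) \<longlonglongrightarrow> walk a x k + 0 * wobble R a x"
      using LIMSEQ_inverse_real_of_nat by (intro tendsto_intros) (simp add: divide_inverse)
    show "\<exists>N. \<forall>n\<ge>N. walk a x \<kappa> \<le> walk a x k + 1 / real (Suc n) * wobble R a x"
      using * that by (auto simp: near_min_def)
  qed
  then show "near_min R 0 a \<kappa> x"
    by (auto simp: near_min_def)
qed (auto intro: near_min_antimono)

text \<open>The window is finite, and finitely many strict inequalities survive a small enough
  margin.\<close>

lemma clear_min_eventually:
  assumes "clear_min R 0 a \<kappa> x"
  shows "\<forall>\<^sub>F n in sequentially. clear_min R (1 / real (Suc n)) a \<kappa> x"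
proof -
  have "\<forall>\<^sub>F n in sequentially. k \<noteq> \<kappa> \<longrightarrow>
      walk a x \<kappa> + 1 / real (Suc n) * wobble R a x < walk a x k" if "k \<in> {- int R..int R}" for k
  proof (cases "k = \<kappa>")
    case False
    have "(\<lambda>n. walk a x \<kappa> + 1 / real (Suc n) * wobble R a x) \<longlonglongrightarrow> walk a x \<kappa> + 0 * wobble R a x"
      using LIMSEQ_inverse_real_of_nat by (intro tendsto_intros) (simp add: divide_inverse)
    moreover have "walk a x \<kappa> + 0 * wobble R a x < walk a x k"
      using assms that False by (auto simp: clear_min_def)
    ultimately show ?thesis
      using order_tendstoD(2) False by fastforce
  qed simp
  then show ?thesis
    unfolding clear_min_def by (intro eventually_ball_finite) auto
qed

section \<open>Probabilities of the limiting window events\<close>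

text \<open>As \<open>R\<close> grows the exact window minima decrease to \<open>W\<close>, which
  determines \<open>R1\<close>; for each fixed \<open>R\<close> the margin then tends to 0. The
  lower bound rests on \<open>uniq\<close>, by which the minimum is almost surely strict on
  \<open>W\<close>.\<close>

lemma (in prob_space) window_probabilities:
  fixes X :: "nat \<times> int \<Rightarrow> 'a \<Rightarrow> real"
  assumes I: "finite I" and X: "\<And>j i. j \<in> I \<Longrightarrow> X (j, i) \<in> borel_measurable M"
    and R0: "\<And>j. j \<in> I \<Longrightarrow> \<bar>\<kappa> j\<bar> \<le> int R0" and "e > 0"
    and uniq: "AE \<omega> in M. \<forall>j\<in>I. (\<forall>k. walk (a j) (\<lambda>i. X (j, i) \<omega>) (\<kappa> j) \<le> walk (a j) (\<lambda>i. X (j, i) \<omega>) k) \<longrightarrow>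
        (\<forall>k. k \<noteq> \<kappa> j \<longrightarrow> walk (a j) (\<lambda>i. X (j, i) \<omega>) (\<kappa> j) < walk (a j) (\<lambda>i. X (j, i) \<omega>) k)"
  defines "W \<equiv> {\<omega> \<in> space M. \<forall>j\<in>I. \<forall>k. walk (a j) (\<lambda>i. X (j, i) \<omega>) (\<kappa> j) \<le> walk (a j) (\<lambda>i. X (j, i) \<omega>) k}"
  shows "\<exists>R1\<ge>R0. \<forall>R\<ge>R1. \<forall>\<^sub>F n in sequentially.
    prob {\<omega> \<in> space M. \<forall>j\<in>I. near_min R (1 / real (Suc n)) (a j) (\<kappa> j) (\<lambda>i. X (j, i) \<omega>)} < prob W + e \<and>
    prob W - e < prob {\<omega> \<in> space M. \<forall>j\<in>I. clear_min R (1 / real (Suc n)) (a j) (\<kappa> j) (\<lambda>i. X (j, i) \<omega>)}"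
proof -
  define U where "U R \<delta> = {\<omega> \<in> space M. \<forall>j\<in>I. near_min R \<delta> (a j) (\<kappa> j) (\<lambda>i. X (j, i) \<omega>)}" for R \<delta>
  define D where "D R \<delta> = {\<omega> \<in> space M. \<forall>j\<in>I. clear_min R \<delta> (a j) (\<kappa> j) (\<lambda>i. X (j, i) \<omega>)}" for R \<delta>
  have UD: "U R \<delta> \<in> events" "D R \<delta> \<in> events" if "R \<ge> R0" for R \<delta>
  proof -
    have \<kappa>: "\<bar>\<kappa> j\<bar> \<le> int R" if "j \<in> I" for j
      using R0[OF that] \<open>R \<ge> R0\<close> by linarith
    show "U R \<delta> \<in> events"
      unfolding U_def pred_def[symmetric] using X \<kappa> I
      by (intro pred_intros_finite near_min_clear_min_measurable) auto
    show "D R \<delta> \<in> events"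
      unfolding D_def pred_def[symmetric] using X \<kappa> I
      by (intro pred_intros_finite near_min_clear_min_measurable) auto
  qed
  have Umono: "U R \<delta> \<subseteq> U R \<delta>'" and Dmono: "D R \<delta>' \<subseteq> D R \<delta>" if "\<delta> \<le> \<delta>'" for R \<delta> \<delta>'
    using near_min_antimono[OF _ order_refl that] clear_min_mono[OF _ that] unfolding U_def D_def by blast+
  have inv: "1 / real (Suc k) \<le> 1 / real (Suc n)" if "n \<le> k" for n k
    using that by (intro divide_left_mono) auto
  \<comment> \<open>With slack 0 the events decrease in the window radius, so continuity from above
    applies.\<close>
  have "(\<lambda>n. prob (U (R0 + n) 0)) \<longlonglongrightarrow> prob (\<Inter>n. U (R0 + n) 0)"
    using UD by (intro finite_Lim_measure_decseq) (auto simp: decseq_def U_def intro: near_min_antimono)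
  also have "(\<Inter>n. U (R0 + n) 0) = W"
  proof (intro equalityI subsetI)
    fix \<omega> assume \<omega>: "\<omega> \<in> (\<Inter>n. U (R0 + n) 0)"
    show "\<omega> \<in> W"
      unfolding W_def
    proof (intro CollectI conjI ballI allI)
      show "\<omega> \<in> space M"
        using \<omega> by (auto simp: U_def)
      fix j k assume "j \<in> I"
      then have "near_min (R0 + nat \<bar>k\<bar>) 0 (a j) (\<kappa> j) (\<lambda>i. X (j, i) \<omega>)"
        using \<omega> by (auto simp: U_def)
      moreover have "k \<in> {- int (R0 + nat \<bar>k\<bar>)..int (R0 + nat \<bar>k\<bar>)}"
        by auto
      ultimately show "walk (a j) (\<lambda>i. X (j, i) \<omega>) (\<kappa> j) \<le> walk (a j) (\<lambda>i. X (j, i) \<omega>) k"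
        unfolding near_min_def by simp
    qed
  qed (auto simp: W_def U_def near_min_def)
  finally have "\<forall>\<^sub>F n in sequentially. prob (U (R0 + n) 0) < prob W + e / 2"
    using \<open>e > 0\<close> by (intro order_tendstoD) auto
  then obtain n0 where n0: "\<And>n. n \<ge> n0 \<Longrightarrow> prob (U (R0 + n) 0) < prob W + e / 2"
    by (auto simp: eventually_sequentially)
  have "\<forall>\<^sub>F n in sequentially. prob (U R (1 / real (Suc n))) < prob W + e \<and>
      prob W - e < prob (D R (1 / real (Suc n)))" if R: "R \<ge> R0 + n0" for R
  proof -
    have "prob (U R 0) < prob W + e / 2"
      using n0[of "R - R0"] R by simp
    moreover have "(\<lambda>n. prob (U R (1 / real (Suc n)))) \<longlonglongrightarrow> prob (\<Inter>n. U R (1 / real (Suc n)))"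
      using UD R
      by (intro finite_Lim_measure_decseq decseq_SucI Umono inv) auto
    moreover have "(\<Inter>n. U R (1 / real (Suc n))) = U R 0"
      by (auto simp: U_def near_min_iff_inverse simp del: of_nat_Suc)
    ultimately have 1: "\<forall>\<^sub>F n in sequentially. prob (U R (1 / real (Suc n))) < prob W + e"
      using \<open>e > 0\<close> by (intro order_tendstoD(2)) auto
    have "W \<in> events"
      unfolding \<open>(\<Inter>n. U (R0 + n) 0) = W\<close>[symmetric] using UD by (intro sets.countable_INT) auto
    \<comment> \<open>A minimum over all integers is almost surely strict, hence clear with margin 0
      in the window.\<close>
    then have "prob W \<le> prob (D R 0)"
    proof (intro finite_measure_mono_AE)
      show "AE \<omega> in M. \<omega> \<in> W \<longrightarrow> \<omega> \<in> D R 0"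
        using uniq by eventually_elim (simp add: W_def D_def clear_min_def)
    qed (use UD R in simp)
    moreover have "(\<lambda>n. prob (D R (1 / real (Suc n)))) \<longlonglongrightarrow> prob (\<Union>n. D R (1 / real (Suc n)))"
      using UD R
      by (intro finite_Lim_measure_incseq incseq_SucI Dmono inv) auto
    moreover have "(\<Union>n. D R (1 / real (Suc n))) = D R 0"
    proof (intro equalityI subsetI)
      fix \<omega> assume \<omega>: "\<omega> \<in> D R 0"
      then have "\<forall>\<^sub>F n in sequentially. \<forall>j\<in>I. clear_min R (1 / real (Suc n)) (a j) (\<kappa> j) (\<lambda>i. X (j, i) \<omega>)"
        using I by (intro eventually_ball_finite ballI clear_min_eventually) (auto simp: D_def)
      then obtain n where "\<forall>j\<in>I. clear_min R (1 / real (Suc n)) (a j) (\<kappa> j) (\<lambda>i. X (j, i) \<omega>)"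
        by (auto simp: eventually_sequentially)
      then show "\<omega> \<in> (\<Union>n. D R (1 / real (Suc n)))"
        using \<omega> by (auto simp: D_def)
    next
      fix \<omega> assume "\<omega> \<in> (\<Union>n. D R (1 / real (Suc n)))"
      then obtain n where "\<omega> \<in> D R (1 / real (Suc n))"
        by blast
      then show "\<omega> \<in> D R 0"
        using Dmono[of 0 "1 / real (Suc n)" R] by auto
    qed
    ultimately have "\<forall>\<^sub>F n in sequentially. prob W - e < prob (D R (1 / real (Suc n)))"
      using \<open>e > 0\<close> by (intro order_tendstoD(1)) auto
    with 1 show ?thesis
      by eventually_elim simp
  qed
  then show ?thesis
    unfolding U_def D_def by (intro exI[of _ "R0 + n0"]) auto
qed

text \<open>The rows of \<open>X\<close> are disjoint parts of an independent family, so events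
  about different rows are independent. By uniqueness of the arg min, the event of row
  \<open>j\<close> is almost surely \<open>L j \<omega> = \<kappa> j\<close>.\<close>

lemma (in prob_space) prob_argmins_eq_prod:
  fixes X :: "nat \<times> int \<Rightarrow> 'a \<Rightarrow> real"
  assumes I: "finite I" and ind: "indep_vars (\<lambda>_. borel) X (I \<times> UNIV)"
    and L: "\<And>j. j \<in> I \<Longrightarrow> as_argmin M (\<lambda>k \<omega>. walk (a j) (\<lambda>i. X (j, i) \<omega>) k) (L j)"
  shows "prob {\<omega> \<in> space M. \<forall>j\<in>I. \<forall>k. walk (a j) (\<lambda>i. X (j, i) \<omega>) (\<kappa> j) \<le> walk (a j) (\<lambda>i. X (j, i) \<omega>) k} =
    (\<Prod>j\<in>I. prob {\<omega> \<in> space M. L j \<omega> = \<kappa> j})"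
proof (cases "I = {}")
  case True
  then show ?thesis
    by (simp add: prob_space)
next
  case False
  define Q where "Q j x \<longleftrightarrow> (\<forall>k. walk (a j) x (\<kappa> j) \<le> walk (a j) x k)" for j x
  define A where "A j = {y \<in> space (PiM ({j} \<times> UNIV) (\<lambda>_. borel)). Q j (\<lambda>i. y (j, i))}" for j
  let ?r = "\<lambda>j \<omega>. restrict (\<lambda>p. X p \<omega>) ({j} \<times> UNIV)"
  have X: "X (j, i) \<in> borel_measurable M" if "j \<in> I" for j i
    using ind that by (auto simp: indep_vars_def)
  have ind': "indep_vars (\<lambda>j. PiM ({j} \<times> UNIV) (\<lambda>_. borel)) ?r I"
    by (rule indep_vars_restrict[OF ind]) (auto simp: disjoint_family_on_def)
  have Q: "Measurable.pred N (\<lambda>\<omega>. Q j (\<lambda>i. Y i \<omega>))" if "\<And>i. Y i \<in> borel_measurable N"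
    for j and N :: "'c measure" and Y
  proof -
    have [measurable]: "(\<lambda>\<omega>. walk (a j) (\<lambda>i. Y i \<omega>) k) \<in> borel_measurable N" for k
      by (rule walk_measurable) (rule that)
    show ?thesis
      unfolding Q_def by measurable
  qed
  have A: "A j \<in> sets (PiM ({j} \<times> UNIV) (\<lambda>_. borel))" for j
    unfolding A_def pred_def[symmetric] by (intro Q measurable_component_singleton) auto
  have eq: "?r j -` A j \<inter> space M = {\<omega> \<in> space M. Q j (\<lambda>i. X (j, i) \<omega>)}" if "j \<in> I" for j
    using ind' that by (auto simp: A_def indep_vars_def dest!: measurable_space)
  have "{\<omega> \<in> space M. \<forall>j\<in>I. Q j (\<lambda>i. X (j, i) \<omega>)} = (\<Inter>j\<in>I. ?r j -` A j \<inter> space M)"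
    using False eq by auto
  also have "prob \<dots> = (\<Prod>j\<in>I. prob (?r j -` A j \<inter> space M))"
    by (rule indep_varsD_finite[OF ind' False I A])
  also have "\<dots> = (\<Prod>j\<in>I. prob {\<omega> \<in> space M. L j \<omega> = \<kappa> j})"
  proof (intro prod.cong refl)
    fix j assume j: "j \<in> I"
    have [measurable]: "L j \<in> measurable M (count_space UNIV)"
      and ae: "AE \<omega> in M. \<forall>k. is_arg_min (walk (a j) (\<lambda>i. X (j, i) \<omega>)) (\<lambda>_. True) k \<longleftrightarrow> k = L j \<omega>"
      using L[OF j] by (auto simp: as_argmin_def)
    have "{\<omega> \<in> space M. Q j (\<lambda>i. X (j, i) \<omega>)} \<in> events"
      using X[OF j] by (intro Q[unfolded pred_def])
    moreover have "AE \<omega> in M. Q j (\<lambda>i. X (j, i) \<omega>) \<longleftrightarrow> L j \<omega> = \<kappa> j"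
      using ae by (auto simp: Q_def is_arg_min_def not_less elim!: eventually_mono)
    ultimately show "prob (?r j -` A j \<inter> space M) = prob {\<omega> \<in> space M. L j \<omega> = \<kappa> j}"
      unfolding eq[OF j] by (intro finite_measure_eq_AE) auto
  qed
  finally show ?thesis
    unfolding Q_def .
qed

section \<open>Localization for a fixed sample size\<close>

text \<open>A window reaches at most \<open>2 * R + 2\<close> integers from its change point, so a
  gap of \<open>4 * R + 4\<close> keeps neighbouring windows apart.\<close>

lemma signal_spacing:
  assumes sig: "piecewise_constant_signal N J tau nu theta"
    and sp: "\<And>j. j \<le> J \<Longrightarrow> (of_int K + 1) * w < real (tau (Suc j)) - real (tau j)"
    and K: "K \<ge> 2" and R: "2 * real R + 2 \<le> w"
  shows spacing_mono: "i \<le> j \<Longrightarrow> j \<le> Suc J \<Longrightarrow> tau i \<le> tau j"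
    and spacing_gap: "j \<le> J \<Longrightarrow> tau j + (4 * R + 4) < tau (Suc j)"
    and spacing_range: "j \<le> Suc J \<Longrightarrow> 1 \<le> tau j \<and> tau j \<le> N"
proof -
  have mono: "tau i \<le> tau j" if "i \<le> j" "j \<le> Suc J" for i j
    using that(1) that(2)
  proof (induction j rule: dec_induct)
    case (step n)
    then have "tau n < tau (Suc n)"
      using sig by (simp add: piecewise_constant_signal_def)
    with step show ?case by simp
  qed simp
  show "i \<le> j \<Longrightarrow> j \<le> Suc J \<Longrightarrow> tau i \<le> tau j"
    by (rule mono)
  have "2 * w \<le> (of_int K + 1) * w"
    using K R by (intro mult_right_mono) auto
  then have "4 * real R + 4 \<le> (of_int K + 1) * w"
    using R by linarith
  then show "tau j + (4 * R + 4) < tau (Suc j)" if "j \<le> J"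
    using sp[OF that] by linarith
  show "1 \<le> tau j \<and> tau j \<le> N" if "j \<le> Suc J"
    using mono[of 0 j] mono[of j "Suc J"] that sig by (simp add: piecewise_constant_signal_def)
qed

text \<open>Where the first stage succeeds and \<open>tail_good\<close> holds at every change point,
  localization applies to all of them at once, and \<open>E\<close> lies between the clear and the
  near event. \<open>B\<close> is the union bound for the failure of
  \<open>tail_good\<close>.\<close>

lemma (in prob_space) second_stage_sandwich:
  fixes eps Y :: "nat \<Rightarrow> 'a \<Rightarrow> real" and tau2 :: "nat \<Rightarrow> 'a \<Rightarrow> nat" and K :: int
  assumes sig: "piecewise_constant_signal N J tau nu theta"
    and Y: "\<And>i \<omega>. Y i \<omega> = theta i + eps i \<omega>"
    and ind: "indep_vars (\<lambda>_. borel) eps {1..N}"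
    and sub: "\<And>i. i \<in> {1..N} \<Longrightarrow> subgaussian M \<sigma> (eps i)" and \<sigma>: "\<sigma> > 0"
    and \<Delta>: "\<And>j. j \<in> {1..J} \<Longrightarrow> nu j - nu (j - 1) = \<Delta> j" "\<And>j. j \<in> {1..J} \<Longrightarrow> \<Delta> j \<noteq> 0"
    and m: "m \<ge> 2"
    and Jhat: "statistic_of M (subsample m N) Y (count_space UNIV) Jhat"
    and tau1: "\<And>i. statistic_of M (subsample m N) Y borel (tau1 i)"
    and nu1: "\<And>i. statistic_of M (subsample m N) Y borel (nu1 i)"
    and K: "K \<ge> 2"
    and tau2: "\<And>i \<omega>. \<omega> \<in> space M \<Longrightarrow> 1 \<le> i \<Longrightarrow> i \<le> Jhat \<omega> \<Longrightarrow>
         tau2 i \<omega> = second_stage_estimator (\<lambda>j. Y j \<omega>)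
           (second_stage_set m N (of_int K * w) (tau1 i \<omega>)) (nu1 (i - 1) \<omega>) (nu1 i \<omega>)"
    and R: "2 * real R + 2 \<le> w"
    and sp: "\<And>j. j \<le> J \<Longrightarrow> (of_int K + 1) * w < real (tau (Suc j)) - real (tau j)"
    and \<delta>: "\<rho> \<le> \<delta>" "\<delta> \<le> 1" "\<And>j. j \<in> {1..J} \<Longrightarrow> \<delta> \<le> \<bar>\<Delta> j\<bar> / 4"
    and \<kappa>: "\<And>j. j \<in> {1..J} \<Longrightarrow> \<bar>\<kappa> j\<bar> \<le> int R"
  defines "G \<equiv> {\<omega> \<in> space M. Jhat \<omega> = J \<and>
          (\<forall>i\<in>{1..J}. \<bar>tau1 i \<omega> - real (tau i)\<bar> \<le> w) \<and> (\<forall>i\<in>{0..J}. \<bar>nu1 i \<omega> - nu i\<bar> \<le> \<rho>)}"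
    and "E \<equiv> {\<omega> \<in> space M. Jhat \<omega> = J \<and> (\<forall>j\<in>{1..J}. lambda2 m N (tau j) (tau2 j \<omega>) = \<kappa> j)}"
    and "B \<equiv> (\<Sum>j\<in>{1..J}. 2 * (exp (- ((\<bar>\<Delta> j\<bar> / 4)\<^sup>2 / (2 * \<sigma>\<^sup>2))) ^ R / (1 - exp (- ((\<bar>\<Delta> j\<bar> / 4)\<^sup>2 / (2 * \<sigma>\<^sup>2))))))"
  shows "prob E \<le> prob {\<omega> \<in> space M. \<forall>j\<in>{1..J}.
            near_min R \<delta> (\<Delta> j) (\<kappa> j) (\<lambda>i. eps (nonmultiple_at m (tau j) i) \<omega>)} + (1 - prob G) + B"
    and "prob {\<omega> \<in> space M. \<forall>j\<in>{1..J}.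
            clear_min R \<delta> (\<Delta> j) (\<kappa> j) (\<lambda>i. eps (nonmultiple_at m (tau j) i) \<omega>)} \<le> prob E + (1 - prob G) + B"
proof -
  have geom: "\<And>i j. i \<le> j \<Longrightarrow> j \<le> Suc J \<Longrightarrow> tau i \<le> tau j"
    "\<And>j. j \<le> J \<Longrightarrow> tau j + (4 * R + 4) < tau (Suc j)"
    "\<And>j. j \<le> Suc J \<Longrightarrow> 1 \<le> tau j \<and> tau j \<le> N"
    by (rule signal_spacing[OF sig sp K R]; assumption)+
  define U where "U = {\<omega> \<in> space M. \<forall>j\<in>{1..J}.
            near_min R \<delta> (\<Delta> j) (\<kappa> j) (\<lambda>i. eps (nonmultiple_at m (tau j) i) \<omega>)}"
  define D where "D = {\<omega> \<in> space M. \<forall>j\<in>{1..J}.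
            clear_min R \<delta> (\<Delta> j) (\<kappa> j) (\<lambda>i. eps (nonmultiple_at m (tau j) i) \<omega>)}"
  define T where "T j = {\<omega> \<in> space M. \<not> tail_good m N R (tau j) (\<Delta> j) (\<lambda>i. eps i \<omega>)}" for j
  have tj: "tau j \<in> {1..N}" "2 * R + 2 \<le> tau j" "tau j + 2 * R \<le> N" if "j \<in> {1..J}" for j
  proof -
    have "Suc (j - 1) = j" "j - 1 \<le> J" "j \<le> J"
      using that by auto
    then show "tau j \<in> {1..N}" "2 * R + 2 \<le> tau j" "tau j + 2 * R \<le> N"
      using geom(2)[of "j - 1"] geom(2)[of j] geom(3)[of j] geom(3)[of "Suc j"] by auto
  qed
  have eps[measurable]: "eps i \<in> borel_measurable M" if "i \<in> {1..N}" for i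
    using ind that by (auto simp: indep_vars_def)
  have Y': "Y i \<in> borel_measurable M" if "i \<in> {1..N}" for i
  proof -
    note [measurable] = eps[OF that]
    show ?thesis
      unfolding Y[abs_def] by measurable
  qed
  have sY: "Y i \<in> borel_measurable M" if "i \<in> subsample m N" for i
    using that by (intro Y') (auto simp: subsample_def)
  have Jhat'[measurable]: "Jhat \<in> measurable M (count_space UNIV)"
    by (rule statistic_of_measurable[OF Jhat sY])
  have tau1'[measurable]: "tau1 i \<in> borel_measurable M" and nu1'[measurable]: "nu1 i \<in> borel_measurable M" for i
    by (rule statistic_of_measurable[OF tau1 sY] statistic_of_measurable[OF nu1 sY]; assumption)+
  \<comment> \<open>\<open>tau2\<close> is prescribed only up to the estimated number of change
    points, \<open>t2\<close> everywhere. They agree where that number is \<open>J\<close>, and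
    \<open>t2\<close> is measurable, so \<open>E\<close> is an event.\<close>
  define t2 where "t2 j \<omega> = second_stage_estimator (\<lambda>i. Y i \<omega>)
           (second_stage_set m N (of_int K * w) (tau1 j \<omega>)) (nu1 (j - 1) \<omega>) (nu1 j \<omega>)" for j \<omega>
  have t2[measurable]: "t2 j \<in> measurable M (count_space UNIV)" for j
    unfolding t2_def by (intro second_stage_estimator_measurable Y' tau1' nu1')
  have E: "E = {\<omega> \<in> space M. Jhat \<omega> = J \<and> (\<forall>j\<in>{1..J}. lambda2 m N (tau j) (t2 j \<omega>) = \<kappa> j)}"
    unfolding E_def t2_def using tau2 by auto
  have [measurable]: "E \<in> events"
    unfolding E by measurable
  have [measurable]: "G \<in> events"
    unfolding G_def by measurable
  have pos: "eps (nonmultiple_at m (tau j) i) \<in> borel_measurable M" if "j \<in> {1..J}" "\<bar>i\<bar> \<le> int R" for i j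
  proof (rule eps)
    note p = nonmultiple_at_close[OF m that(2) tj(2)[OF that(1)]]
    show "nonmultiple_at m (tau j) i \<in> {1..N}"
      using p(2) nonmultiple_at_ge_1[OF m p(1)] tj(3)[OF that(1)] by auto
  qed
  have [measurable]: "U \<in> events" "D \<in> events"
    unfolding U_def D_def pred_def[symmetric] using pos \<kappa>
    by (auto intro!: pred_intros_finite near_min_clear_min_measurable)
  have T[measurable]: "T j \<in> events"
    and PT: "prob (T j) \<le> 2 * (exp (- ((\<bar>\<Delta> j\<bar> / 4)\<^sup>2 / (2 * \<sigma>\<^sup>2))) ^ R / (1 - exp (- ((\<bar>\<Delta> j\<bar> / 4)\<^sup>2 / (2 * \<sigma>\<^sup>2)))))"
    if "j \<in> {1..J}" for j
    using tail_good_prob[OF ind sub \<sigma> \<Delta>(2)[OF that], of "tau j" m R] tj(1)[OF that] unfolding T_def by simp_all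
  have TT: "(\<Union>j\<in>{1..J}. T j) \<in> events"
    using T by auto
  have "prob (\<Union>j\<in>{1..J}. T j) \<le> (\<Sum>j\<in>{1..J}. prob (T j))"
    using T by (intro finite_measure_subadditive_finite) auto
  also have "\<dots> \<le> B"
    unfolding B_def by (intro sum_mono PT)
  finally have B: "prob (\<Union>j\<in>{1..J}. T j) \<le> B" .
  have le: "prob A \<le> prob C + (1 - prob G) + B"
    if "A \<subseteq> C \<union> (space M - G) \<union> (\<Union>j\<in>{1..J}. T j)" and [measurable]: "C \<in> events" for A C
  proof -
    have "prob A \<le> prob (C \<union> (space M - G) \<union> (\<Union>j\<in>{1..J}. T j))"
      using that(1) TT by (intro finite_measure_mono) auto
    also have "\<dots> \<le> prob (C \<union> (space M - G)) + prob (\<Union>j\<in>{1..J}. T j)"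
      using TT by (intro measure_Un_le) auto
    also have "prob (C \<union> (space M - G)) \<le> prob C + prob (space M - G)"
      by (intro measure_Un_le) auto
    also have "prob (space M - G) = 1 - prob G"
      by (rule prob_compl) simp
    finally show ?thesis
      using B by simp
  qed
  have loc: "(lambda2 m N (tau j) (t2 j \<omega>) = \<kappa> j \<longrightarrow> near_min R \<delta> (\<Delta> j) (\<kappa> j) (\<lambda>i. eps (nonmultiple_at m (tau j) i) \<omega>)) \<and>
      (clear_min R \<delta> (\<Delta> j) (\<kappa> j) (\<lambda>i. eps (nonmultiple_at m (tau j) i) \<omega>) \<longrightarrow> lambda2 m N (tau j) (t2 j \<omega>) = \<kappa> j)"
    if \<omega>: "\<omega> \<in> G" "\<omega> \<notin> T j" and j: "j \<in> {1..J}" for j \<omega>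
  proof -
    have Gj: "\<bar>real (tau j) - tau1 j \<omega>\<bar> \<le> w" "\<bar>nu1 (j - 1) \<omega> - nu (j - 1)\<bar> \<le> \<rho>" "\<bar>nu1 j \<omega> - nu j\<bar> \<le> \<rho>"
      using \<omega>(1) j by (auto simp: G_def abs_minus_commute)
    have Rw: "real (2 * R + 2) \<le> w"
      using R by simp
    \<comment> \<open>On \<open>G\<close> the second-stage set reaches at most
      \<open>(K + 1) * w\<close> from \<open>tau j\<close>, less than the spacing, so it meets only
      the two adjacent segments.\<close>
    have yr: "Y i \<omega> = nu j + eps i \<omega>" if "tau j < i" "i \<in> second_stage_set m N (of_int K * w) (tau1 j \<omega>)" for i
    proof -
      have "real i < real (tau (Suc j))"
        using that(2) Gj(1) sp[of j] j by (simp add: second_stage_set_def algebra_simps abs_le_iff)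
      then have "theta i = nu j"
        using that(1) sig j by (auto simp: piecewise_constant_signal_def)
      then show ?thesis
        by (simp add: Y)
    qed
    have yl: "Y i \<omega> = nu (j - 1) + eps i \<omega>" if "i \<le> tau j" "i \<in> second_stage_set m N (of_int K * w) (tau1 j \<omega>)" for i
    proof -
      have j1: "Suc (j - 1) = j" "j - 1 \<le> J"
        using j by auto
      have "real (tau (j - 1)) < real i"
        using that(2) Gj(1) sp[OF j1(2)] unfolding j1(1)
        by (simp add: second_stage_set_def algebra_simps abs_le_iff)
      with j1 have "theta i = nu (j - 1)"
        using that(1) sig unfolding piecewise_constant_signal_def by (metis of_nat_less_iff)
      then show ?thesis
        by (simp add: Y)
    qed
    have \<Delta>j: "nu j - nu (j - 1) = \<Delta> j"
      by (rule \<Delta>(1)[OF j])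
    have ne: "nu (j - 1) \<noteq> nu j"
      using \<Delta>(2)[OF j] \<Delta>j by auto
    have tail: "tail_good m N R (tau j) (nu j - nu (j - 1)) (\<lambda>i. eps i \<omega>)"
      unfolding \<Delta>j using \<omega> by (auto simp: T_def G_def)
    have \<delta>4: "\<delta> \<le> \<bar>nu j - nu (j - 1)\<bar> / 4"
      unfolding \<Delta>j by (rule \<delta>(3)[OF j])
    show ?thesis
      using second_stage_localization[where e = "\<lambda>i. eps i \<omega>" and y = "\<lambda>i. Y i \<omega>",
          OF m tj(1)[OF j] Gj(1) K Rw tj(2,3)[OF j] yr yl Gj(2,3) \<delta>(1,2) \<delta>4 ne tail \<kappa>[OF j]]
      unfolding \<Delta>j t2_def by blast
  qed
  show "prob E \<le> prob U + (1 - prob G) + B"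
  proof (rule le)
    show "E \<subseteq> U \<union> (space M - G) \<union> (\<Union>j\<in>{1..J}. T j)"
      using loc unfolding E U_def by blast
  qed simp
  show "prob D \<le> prob E + (1 - prob G) + B"
  proof (rule le)
    show "D \<subseteq> E \<union> (space M - G) \<union> (\<Union>j\<in>{1..J}. T j)"
    proof
      fix \<omega> assume "\<omega> \<in> D"
      then show "\<omega> \<in> E \<union> (space M - G) \<union> (\<Union>j\<in>{1..J}. T j)"
        using loc[of \<omega>] unfolding E D_def by (cases "\<omega> \<in> G") (auto simp: G_def)
    qed
  qed simp
qed

text \<open>Pairs of a change point and a number map injectively to sample indices, and each index
  lies in the segment whose law the matching \<open>X\<close> has. The two finite families thus have
  the same joint law, exactly and not only in the limit.\<close>

lemma (in prob_space) window_law: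
  fixes eps :: "nat \<Rightarrow> 'a \<Rightarrow> real" and X :: "nat \<times> int \<Rightarrow> 'b \<Rightarrow> real"
  assumes sig: "piecewise_constant_signal N J tau nu theta"
    and ind: "indep_vars (\<lambda>_. borel) eps {1..N}"
    and law: "\<And>j i. j \<le> J \<Longrightarrow> i \<in> {tau j + 1..tau (Suc j)} \<Longrightarrow> distr M borel (eps i) = law j"
    and m: "m \<ge> 2" and K: "K \<ge> 2" and R: "2 * real R + 2 \<le> w"
    and sp: "\<And>j. j \<le> J \<Longrightarrow> (of_int K + 1) * w < real (tau (Suc j)) - real (tau j)"
    and P: "prob_space P" "prob_space.indep_vars P (\<lambda>_. borel) X ({1..J} \<times> UNIV)"
      "\<And>j i. j \<in> {1..J} \<Longrightarrow> distr P borel (X (j, i)) = law (if 0 < i then j else j - 1)"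
    and \<kappa>: "\<And>j. j \<in> {1..J} \<Longrightarrow> \<bar>\<kappa> j\<bar> \<le> int R"
  shows "prob {\<omega> \<in> space M. \<forall>j\<in>{1..J}. near_min R \<delta> (a j) (\<kappa> j) (\<lambda>i. eps (nonmultiple_at m (tau j) i) \<omega>)} =
      measure P {\<omega> \<in> space P. \<forall>j\<in>{1..J}. near_min R \<delta> (a j) (\<kappa> j) (\<lambda>i. X (j, i) \<omega>)}" (is ?near)
    and "prob {\<omega> \<in> space M. \<forall>j\<in>{1..J}. clear_min R \<delta> (a j) (\<kappa> j) (\<lambda>i. eps (nonmultiple_at m (tau j) i) \<omega>)} =
      measure P {\<omega> \<in> space P. \<forall>j\<in>{1..J}. clear_min R \<delta> (a j) (\<kappa> j) (\<lambda>i. X (j, i) \<omega>)}" (is ?clear)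
proof -
  have geom: "\<And>i j. i \<le> j \<Longrightarrow> j \<le> Suc J \<Longrightarrow> tau i \<le> tau j"
    "\<And>j. j \<le> J \<Longrightarrow> tau j + (4 * R + 4) < tau (Suc j)"
    "\<And>j. j \<le> Suc J \<Longrightarrow> 1 \<le> tau j \<and> tau j \<le> N"
    by (rule signal_spacing[OF sig sp K R]; assumption)+
  define I where "I = {1..J} \<times> {- int R..int R}"
  define f where "f = (\<lambda>(j, i). nonmultiple_at m (tau j) i)"
  have tj: "2 * R + 2 \<le> tau j" "tau j + 2 * R \<le> N" if "j \<in> {1..J}" for j
  proof -
    have "Suc (j - 1) = j" "j - 1 \<le> J" "j \<le> J"
      using that by auto
    then show "2 * R + 2 \<le> tau j" "tau j + 2 * R \<le> N"
      using geom(2)[of "j - 1"] geom(2)[of j] geom(3)[of j] geom(3)[of "Suc j"] by auto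
  qed
  have close: "int (nonmultiple_count m (tau j)) + i \<ge> 1" "f (j, i) \<le> tau j + 2 * R" "tau j - (2 * R + 2) < f (j, i)"
    "tau j < f (j, i) \<longleftrightarrow> 0 < i" "1 \<le> f (j, i)" if "(j, i) \<in> I" for j i
    using nonmultiple_at_close[OF m, of i R "tau j"] nonmultiple_at_ge_1[OF m, of "tau j" i] tj[of j] that by (auto simp: I_def f_def)
  \<comment> \<open>The gap between change points orders the windows, so different \<open>j\<close>
    never share an index; within one window the count determines the number.\<close>
  have ordered: "f (j, i) < f (j', i')" if "(j, i) \<in> I" "(j', i') \<in> I" "j < j'" for j i j' i'
    using close(2)[OF that(1)] close(3)[OF that(2)] geom(2)[of j] geom(1)[of "Suc j" j'] that
    by (auto simp: I_def)
  have inj: "inj_on f I"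
  proof (rule inj_onI, clarify)
    fix j i j' i' assume *: "(j, i) \<in> I" "(j', i') \<in> I" "f (j, i) = f (j', i')"
    have j: "j = j'"
      using ordered[OF *(1,2)] ordered[OF *(2,1)] *(3) by (cases j j' rule: linorder_cases) auto
    have "int (nonmultiple_count m (f (j, i))) = int (nonmultiple_count m (tau j)) + i" "int (nonmultiple_count m (f (j', i'))) = int (nonmultiple_count m (tau j')) + i'"
      unfolding f_def prod.case by (rule nonmultiple_count_at[OF m close(1)] *)+
    moreover have "nonmultiple_count m (f (j, i)) = nonmultiple_count m (f (j', i'))"
      by (simp only: *(3))
    moreover have "nonmultiple_count m (tau j) = nonmultiple_count m (tau j')"
      by (simp only: j)
    ultimately have "i = i'"
      by linarith
    with j show "j = j' \<and> i = i'" by simp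
  qed
  have fN: "f ` I \<subseteq> {1..N}"
  proof clarify
    fix j i assume "(j, i) \<in> I"
    then show "f (j, i) \<in> {1..N}"
      using close(2,5)[of j i] tj(2)[of j] by (auto simp: I_def)
  qed
  have ind': "indep_vars (\<lambda>_. borel) (\<lambda>p. eps (f p)) I"
    by (rule indep_vars_reindex[OF indep_vars_subset[OF ind fN] inj])
  have indP: "prob_space.indep_vars P (\<lambda>_. borel) X I"
    by (rule prob_space.indep_vars_subset[OF P(1,2)]) (auto simp: I_def)
  have marg: "distr M borel (eps (f p)) = distr P borel (X p)" if "p \<in> I" for p
  proof -
    obtain j i where p: "p = (j, i)" by (cases p)
    have j: "j \<in> {1..J}"
      using that by (simp add: p I_def)
    note c = close[OF that[unfolded p]]
    show ?thesis
    proof (cases "0 < i")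
      case True
      then have "f (j, i) \<in> {tau j + 1..tau (Suc j)}"
        using c(2,4) geom(2)[of j] j by auto
      then show ?thesis
        using law[of j] P(3)[OF j, of i] True j by (simp add: p)
    next
      \<comment> \<open>Numbers up to and including 0 lie at or before \<open>tau j\<close>, in
        segment \<open>j - 1\<close>.\<close>
      case False
      have "Suc (j - 1) = j"
        using j by simp
      then have "f (j, i) \<in> {tau (j - 1) + 1..tau (Suc (j - 1))}"
        using c(3,4) geom(2)[of "j - 1"] j False by auto
      moreover have "j - 1 \<le> J"
        using j by auto
      ultimately have "distr M borel (eps (f (j, i))) = law (j - 1)"
        by (intro law)
      then show ?thesis
        using P(3)[OF j, of i] False by (simp add: p)
    qed
  qed
  have comp: "(\<lambda>y. y (j, i)) \<in> borel_measurable (PiM I (\<lambda>_. borel))" if "j \<in> {1..J}" "\<bar>i\<bar> \<le> int R"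
    for j and i :: int
    using that by (intro measurable_component_singleton) (auto simp: I_def)
  have restr: "(\<lambda>p\<in>I. Z p) (j, i) = Z (j, i)" if "j \<in> {1..J}" "\<bar>i\<bar> \<le> int R" for j i and Z :: "nat \<times> int \<Rightarrow> real"
    using that by (auto simp: I_def)
  note eq = prob_eq_of_same_marginals[OF prob_space_axioms P(1) ind' indP marg]
  show ?near
  proof -
    let ?Q = "\<lambda>y :: nat \<times> int \<Rightarrow> real. \<forall>j\<in>{1..J}. near_min R \<delta> (a j) (\<kappa> j) (\<lambda>i. y (j, i))"
    have "Measurable.pred (PiM I (\<lambda>_. borel)) ?Q"
      using comp \<kappa> by (intro pred_intros_finite near_min_clear_min_measurable(1)[where X = "\<lambda>i y. y (_, i)"]) auto
    note e = eq[OF _ this]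
    \<comment> \<open>The event reads only coordinates in the window, so restricting to
      \<open>I\<close> does not change it.\<close>
    have r: "?Q (\<lambda>p\<in>I. Z p) \<longleftrightarrow> ?Q Z" for Z
      using restr \<kappa> by (intro ball_cong refl near_min_clear_min_cong(1)) auto
    show ?near
      using e unfolding r by (simp add: f_def)
  qed
  show ?clear
  proof -
    let ?Q = "\<lambda>y :: nat \<times> int \<Rightarrow> real. \<forall>j\<in>{1..J}. clear_min R \<delta> (a j) (\<kappa> j) (\<lambda>i. y (j, i))"
    have "Measurable.pred (PiM I (\<lambda>_. borel)) ?Q"
      using comp \<kappa> by (intro pred_intros_finite near_min_clear_min_measurable(2)[where X = "\<lambda>i y. y (_, i)"]) auto
    note e = eq[OF _ this]
    have r: "?Q (\<lambda>p\<in>I. Z p) \<longleftrightarrow> ?Q Z" for Z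
      using restr \<kappa> by (intro ball_cong refl near_min_clear_min_cong(2)) auto
    show ?clear
      using e unfolding r by (simp add: f_def)
  qed
qed

section \<open>Convergence\<close>

text \<open>Uniqueness is built into \<open>as_argmin\<close>, so a tie at another number has
  probability 0.\<close>

lemma as_argmin_strict:
  assumes "as_argmin P Z L"
  shows "AE \<omega> in P. (\<forall>k. Z \<kappa> \<omega> \<le> Z k \<omega>) \<longrightarrow> (\<forall>k. k \<noteq> \<kappa> \<longrightarrow> Z \<kappa> \<omega> < Z k \<omega>)"
proof -
  have "AE \<omega> in P. \<forall>k. is_arg_min (\<lambda>k. Z k \<omega>) (\<lambda>_. True) k \<longleftrightarrow> k = L \<omega>"
    using assms by (simp add: as_argmin_def)
  then show ?thesis
  proof eventually_elim
    case (elim \<omega>)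
    show ?case
    proof (intro impI allI)
      fix k assume min: "\<forall>k. Z \<kappa> \<omega> \<le> Z k \<omega>" and "k \<noteq> \<kappa>"
      then have "is_arg_min (\<lambda>k. Z k \<omega>) (\<lambda>_. True) \<kappa>"
        by (auto simp: is_arg_min_def not_less)
      with elim \<open>k \<noteq> \<kappa>\<close> have "\<not> is_arg_min (\<lambda>k. Z k \<omega>) (\<lambda>_. True) k"
        by simp
      then show "Z \<kappa> \<omega> < Z k \<omega>"
        using min by (auto simp: is_arg_min_def intro: le_less_trans)
    qed
  qed
qed

text \<open>The limiting noise enters through one array \<open>X\<close> with prescribed marginals,
  so that the noise as given and the noise with flipped signs are both instances. The choices are
  made in the order window radius, margin, sample size.\<close>

lemma second_stage_limit:
  fixes M :: "nat \<Rightarrow> 'a measure" and J :: nat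
    and tau :: "nat \<Rightarrow> nat \<Rightarrow> nat" and nu theta :: "nat \<Rightarrow> nat \<Rightarrow> real"
    and eps Y :: "nat \<Rightarrow> nat \<Rightarrow> 'a \<Rightarrow> real" and K :: int
    and P :: "'b measure" and X :: "nat \<times> int \<Rightarrow> 'b \<Rightarrow> real" and k :: "nat \<Rightarrow> int"
  assumes prob: "\<And>N. prob_space (M N)"
    and signal: "\<forall>\<^sub>F N in sequentially. piecewise_constant_signal N J (tau N) (nu N) (theta N)"
    and observations: "\<And>N i \<omega>. Y N i \<omega> = theta N i + eps N i \<omega>"
    and jumps: "\<forall>\<^sub>F N in sequentially. \<forall>j\<in>{1..J}. nu N j - nu N (j - 1) = Delta j"
      "\<And>j. j \<in> {1..J} \<Longrightarrow> Delta j \<noteq> 0"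
    and noise: "sigma_max > 0"
      "\<forall>\<^sub>F N in sequentially. prob_space.indep_vars (M N) (\<lambda>_. borel) (eps N) {1..N}"
      "\<forall>\<^sub>F N in sequentially. \<forall>i\<in>{1..N}. subgaussian (M N) sigma_max (eps N i)"
      "\<forall>\<^sub>F N in sequentially. \<forall>j\<le>J. \<forall>i\<in>{tau N j + 1..tau N (Suc j)}.
          distr (M N) borel (eps N i) = law j"
    and m: "\<forall>\<^sub>F N in sequentially. m N \<ge> 2"
    and stage1_estimators:
      "\<And>N. statistic_of (M N) (subsample (m N) N) (Y N) (count_space UNIV) (Jhat N)"
      "\<And>N i. statistic_of (M N) (subsample (m N) N) (Y N) borel (tau1 N i)"
      "\<And>N i. statistic_of (M N) (subsample (m N) N) (Y N) borel (nu1 N i)"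
    and stage1_rates: "filterlim w at_top sequentially"
      "w \<in> o(\<lambda>N. min_spacing J (tau N))" "rho \<longlonglongrightarrow> 0"
    and stage1_consistency:
      "(\<lambda>N. measure (M N) {\<omega> \<in> space (M N). Jhat N \<omega> = J \<and>
          (\<forall>i\<in>{1..J}. \<bar>tau1 N i \<omega> - real (tau N i)\<bar> \<le> w N) \<and>
          (\<forall>i\<in>{0..J}. \<bar>nu1 N i \<omega> - nu N i\<bar> \<le> rho N)}) \<longlonglongrightarrow> 1"
    and stage2: "K > 1"
      "\<And>N i \<omega>. \<omega> \<in> space (M N) \<Longrightarrow> 1 \<le> i \<Longrightarrow> i \<le> Jhat N \<omega> \<Longrightarrow>
         tau2 N i \<omega> = second_stage_estimator (\<lambda>j. Y N j \<omega>)
           (second_stage_set (m N) N (of_int K * w N) (tau1 N i \<omega>))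
           (nu1 N (i - 1) \<omega>) (nu1 N i \<omega>)"
    and star: "prob_space P" "prob_space.indep_vars P (\<lambda>_. borel) X ({1..J} \<times> UNIV)"
      "\<And>j i. j \<in> {1..J} \<Longrightarrow> distr P borel (X (j, i)) = law (if 0 < i then j else j - 1)"
    and L: "\<And>j. j \<in> {1..J} \<Longrightarrow> as_argmin P (\<lambda>k \<omega>. walk (Delta j) (\<lambda>i. X (j, i) \<omega>) k) (L j)"
  shows "(\<lambda>N. measure (M N) {\<omega> \<in> space (M N). Jhat N \<omega> = J \<and>
                 (\<forall>j\<in>{1..J}. lambda2 (m N) N (tau N j) (tau2 N j \<omega>) = k j)})
             \<longlonglongrightarrow> (\<Prod>j\<in>{1..J}. measure P {\<omega> \<in> space P. L j \<omega> = k j})"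
    (is "(\<lambda>N. measure (M N) (?E N)) \<longlonglongrightarrow> ?p")
proof -
  interpret P: prob_space P by fact
  define q where "q j = exp (- ((\<bar>Delta j\<bar> / 4)\<^sup>2 / (2 * sigma_max\<^sup>2)))" for j
  define B where "B R = (\<Sum>j\<in>{1..J}. 2 * (q j ^ R / (1 - q j)))" for R
  define G where "G N = {\<omega> \<in> space (M N). Jhat N \<omega> = J \<and>
          (\<forall>i\<in>{1..J}. \<bar>tau1 N i \<omega> - real (tau N i)\<bar> \<le> w N) \<and>
          (\<forall>i\<in>{0..J}. \<bar>nu1 N i \<omega> - nu N i\<bar> \<le> rho N)}" for N
  \<comment> \<open>The limit is 0, left in the shape that the limit rules produce.\<close>
  have B: "B \<longlonglongrightarrow> (\<Sum>j\<in>{1..J}. 2 * (0 / (1 - q j)))"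
    unfolding B_def
  proof (intro tendsto_sum tendsto_mult tendsto_divide tendsto_const LIMSEQ_power_zero)
    fix j assume "j \<in> {1..J}"
    then have "q j < 1"
      using jumps(2) noise(1) by (simp add: q_def)
    then show "norm (q j) < 1" "1 - q j \<noteq> 0"
      by (auto simp: q_def)
  qed
  have X: "X (j, i) \<in> borel_measurable P" if "j \<in> {1..J}" for j i
    using star(2) that by (auto simp: P.indep_vars_def)
  have p: "P.prob {\<omega> \<in> space P. \<forall>j\<in>{1..J}. \<forall>i. walk (Delta j) (\<lambda>i. X (j, i) \<omega>) (k j) \<le> walk (Delta j) (\<lambda>i. X (j, i) \<omega>) i} = ?p"
    by (rule P.prob_argmins_eq_prod[OF _ star(2) L]) auto
  \<comment> \<open>A crude common bound that puts every \<open>k j\<close> into the window.\<close>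
  define R0 where "R0 = nat (\<Sum>j\<in>{1..J}. \<bar>k j\<bar>)"
  have R0: "\<bar>k j\<bar> \<le> int R0" if "j \<in> {1..J}" for j
    using member_le_sum[OF that, of "\<lambda>j. \<bar>k j\<bar>"] by (simp add: R0_def)
  have uniq: "AE \<omega> in P. \<forall>j\<in>{1..J}.
      (\<forall>i. walk (Delta j) (\<lambda>i. X (j, i) \<omega>) (k j) \<le> walk (Delta j) (\<lambda>i. X (j, i) \<omega>) i) \<longrightarrow>
      (\<forall>i. i \<noteq> k j \<longrightarrow> walk (Delta j) (\<lambda>i. X (j, i) \<omega>) (k j) < walk (Delta j) (\<lambda>i. X (j, i) \<omega>) i)"
    by (intro AE_finite_allI as_argmin_strict[OF L]) auto
  have K: "K \<ge> 2"
    using stage2(1) by simp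
  show ?thesis
  proof (rule LIMSEQ_I)
    fix e :: real assume "e > 0"
    \<comment> \<open>Three errors of this size add up below: the window probabilities of the limit,
      the failure of the first stage, and the tails.\<close>
    define e' where "e' = e / 4"
    have e': "e' > 0"
      using \<open>e > 0\<close> by (simp add: e'_def)
    have "\<forall>\<^sub>F R in sequentially. B R < e'"
      using B e' by (intro order_tendstoD(2)[of B 0]) auto
    then obtain R2 where R2: "\<And>R. R \<ge> R2 \<Longrightarrow> B R < e'"
      by (auto simp: eventually_sequentially)
    obtain R1 where R1: "R1 \<ge> R0" and R1': "\<And>R. R \<ge> R1 \<Longrightarrow> \<forall>\<^sub>F n in sequentially.
      P.prob {\<omega> \<in> space P. \<forall>j\<in>{1..J}. near_min R (1 / real (Suc n)) (Delta j) (k j) (\<lambda>i. X (j, i) \<omega>)} < ?p + e' \<and>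
      ?p - e' < P.prob {\<omega> \<in> space P. \<forall>j\<in>{1..J}. clear_min R (1 / real (Suc n)) (Delta j) (k j) (\<lambda>i. X (j, i) \<omega>)}"
      using P.window_probabilities[OF _ X R0 e' uniq] unfolding p by auto
    define R where "R = max R1 R2"
    have kR: "\<bar>k j\<bar> \<le> int R" if "j \<in> {1..J}" for j
      using R0[OF that] R1 by (simp add: R_def)
    have "\<forall>\<^sub>F n in sequentially. 1 / real (Suc n) \<le> \<bar>Delta j\<bar> / 4" if "j \<in> {1..J}" for j
    proof -
      have "\<forall>\<^sub>F n in sequentially. inverse (real (Suc n)) < \<bar>Delta j\<bar> / 4"
        using jumps(2)[OF that] by (intro order_tendstoD(2)[OF LIMSEQ_inverse_real_of_nat]) auto
      then show ?thesis
        by eventually_elim (simp add: inverse_eq_divide)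
    qed
    then have "\<forall>\<^sub>F n in sequentially. \<forall>j\<in>{1..J}. 1 / real (Suc n) \<le> \<bar>Delta j\<bar> / 4"
      by (intro eventually_ball_finite) auto
    moreover have "R1 \<le> R"
      by (simp add: R_def)
    note R1'[OF this]
    ultimately have "\<forall>\<^sub>F n in sequentially. (\<forall>j\<in>{1..J}. 1 / real (Suc n) \<le> \<bar>Delta j\<bar> / 4) \<and>
      P.prob {\<omega> \<in> space P. \<forall>j\<in>{1..J}. near_min R (1 / real (Suc n)) (Delta j) (k j) (\<lambda>i. X (j, i) \<omega>)} < ?p + e' \<and>
      ?p - e' < P.prob {\<omega> \<in> space P. \<forall>j\<in>{1..J}. clear_min R (1 / real (Suc n)) (Delta j) (k j) (\<lambda>i. X (j, i) \<omega>)}"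
      by (rule eventually_conj)
    then obtain n where n: "\<forall>j\<in>{1..J}. 1 / real (Suc n) \<le> \<bar>Delta j\<bar> / 4"
      "P.prob {\<omega> \<in> space P. \<forall>j\<in>{1..J}. near_min R (1 / real (Suc n)) (Delta j) (k j) (\<lambda>i. X (j, i) \<omega>)} < ?p + e'"
      "?p - e' < P.prob {\<omega> \<in> space P. \<forall>j\<in>{1..J}. clear_min R (1 / real (Suc n)) (Delta j) (k j) (\<lambda>i. X (j, i) \<omega>)}"
      by (auto simp: eventually_sequentially)
    define \<delta> where "\<delta> = 1 / real (Suc n)"
    have \<delta>: "0 < \<delta>" "\<delta> \<le> 1" "\<And>j. j \<in> {1..J} \<Longrightarrow> \<delta> \<le> \<bar>Delta j\<bar> / 4"
      using n(1) by (auto simp: \<delta>_def)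
    have "\<forall>\<^sub>F N in sequentially. rho N < \<delta>"
      using stage1_rates(3) \<delta>(1) by (rule order_tendstoD(2))
    moreover have "\<forall>\<^sub>F N in sequentially. 2 * real R + 2 \<le> w N"
      using stage1_rates(1) by (simp add: filterlim_at_top)
    \<comment> \<open>The factor 2 makes \<open>(K + 1) * w N\<close> strictly smaller than the
      spacing, once the spacing is known to be positive.\<close>
    moreover have "\<forall>\<^sub>F N in sequentially. norm (w N) \<le> 1 / (2 * (of_int K + 1)) * norm (min_spacing J (tau N))"
      using K by (intro landau_o.smallD[OF stage1_rates(2)]) simp
    moreover have "\<forall>\<^sub>F N in sequentially. measure (M N) (G N) > 1 - e'"
      using stage1_consistency e' unfolding G_def[symmetric] by (intro order_tendstoD(1)) auto
    ultimately have "\<forall>\<^sub>F N in sequentially. norm (measure (M N) (?E N) - ?p) < e"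
      using signal jumps(1) noise(2,3,4) m
    proof eventually_elim
      case (elim N)
      interpret prob_space "M N" by (rule prob)
      have spacing: "(of_int K + 1) * w N < real (tau N (Suc j)) - real (tau N j)" if "j \<le> J" for j
      proof -
        have pos: "0 < real (tau N (Suc i)) - real (tau N i)" if "i \<le> J" for i
          using elim(5) that by (simp add: piecewise_constant_signal_def)
        have "min_spacing J (tau N) \<in> (\<lambda>i. real (tau N (Suc i)) - real (tau N i)) ` {0..J}"
          unfolding min_spacing_def by (intro Min_in) auto
        then have "0 < min_spacing J (tau N)"
          using pos by auto
        moreover have "min_spacing J (tau N) \<le> real (tau N (Suc j)) - real (tau N j)"
          unfolding min_spacing_def using that by (intro Min_le) auto
        moreover have "0 \<le> w N"
          using elim(2) by linarith
        ultimately show ?thesis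
          using elim(3) K by (simp add: field_simps)
      qed
      have "prob (?E N) \<le> prob {\<omega> \<in> space (M N). \<forall>j\<in>{1..J}.
            near_min R \<delta> (Delta j) (k j) (\<lambda>i. eps N (nonmultiple_at (m N) (tau N j) i) \<omega>)} + (1 - prob (G N)) + B R \<and>
          prob {\<omega> \<in> space (M N). \<forall>j\<in>{1..J}.
            clear_min R \<delta> (Delta j) (k j) (\<lambda>i. eps N (nonmultiple_at (m N) (tau N j) i) \<omega>)} \<le> prob (?E N) + (1 - prob (G N)) + B R"
        unfolding G_def B_def q_def using elim \<delta>
        by (intro conjI second_stage_sandwich[where Y = "Y N" and theta = "theta N" and eps = "eps N"
              and Jhat = "Jhat N" and ?tau1.0 = "tau1 N" and ?nu1.0 = "nu1 N" and ?tau2.0 = "tau2 N", OF elim(5) observations elim(7) _ noise(1) _ jumps(2) elim(10)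
              stage1_estimators K stage2(2) elim(2) spacing _ \<delta>(2,3) kR]) auto
      moreover have "prob {\<omega> \<in> space (M N). \<forall>j\<in>{1..J}.
            near_min R \<delta> (Delta j) (k j) (\<lambda>i. eps N (nonmultiple_at (m N) (tau N j) i) \<omega>)} < ?p + e'"
        using n(2) elim(9)
        by (subst window_law(1)[OF elim(5,7) _ elim(10) K elim(2) spacing star kR]) (auto simp: \<delta>_def)
      moreover have "?p - e' < prob {\<omega> \<in> space (M N). \<forall>j\<in>{1..J}.
            clear_min R \<delta> (Delta j) (k j) (\<lambda>i. eps N (nonmultiple_at (m N) (tau N j) i) \<omega>)}"
        using n(3) elim(9)
        by (subst window_law(2)[OF elim(5,7) _ elim(10) K elim(2) spacing star kR]) (auto simp: \<delta>_def)
      moreover have "B R < e'"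
        by (rule R2) (simp add: R_def)
      ultimately show ?case
        using elim(4) by (simp add: e'_def abs_less_iff)
    qed
    then show "\<exists>no. \<forall>N\<ge>no. norm (measure (M N) (?E N) - ?p) < e"
      by (simp add: eventually_sequentially)
  qed
qed

section \<open>Sign flips, the subsampling step and the conclusion\<close>

lemma walk_sign:
  assumes "s * s = (1::real)"
  shows "walk (s * a) x k = walk a (\<lambda>i. s * x i) k"
proof -
  have "(s * a)\<^sup>2 = (s * s) * a\<^sup>2"
    by (simp add: power2_eq_square)
  then show ?thesis
    using assms by (auto simp: walk_def algebra_simps)
qed

text \<open>The quotient is a positive constant times \<open>N powr (1 - \<gamma>)\<close>, which
  tends to infinity. With a step of at least 2 the non-multiples can be numbered as above.\<close>

lemma eventually_le_subsampling_step:
  fixes K1 \<gamma> :: real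
  assumes "K1 > 0" "\<gamma> < 1"
  shows "\<forall>\<^sub>F N in sequentially. 2 \<le> nat \<lfloor>real N / (K1 * real N powr \<gamma>)\<rfloor>"
proof -
  have "filterlim (\<lambda>N. real N / (K1 * real N powr \<gamma>)) at_top sequentially"
    using assms by real_asymp
  then have "\<forall>\<^sub>F N in sequentially. 2 \<le> real N / (K1 * real N powr \<gamma>)"
    by (simp add: filterlim_at_top)
  then show ?thesis
    by eventually_elim (simp add: le_nat_iff le_floor_iff)
qed

text \<open>At a downward jump the noise enters the criterion with a negative factor, which the
  signed walk of the second conclusion records. Using the size of the jump instead amounts to
  negating the noise on both sides of the change point; this preserves the law if the two adjacent
  noise laws are symmetric, whence the premise of the first conclusion.\<close>

theorem theorem4:
  fixes M :: "nat \<Rightarrow> 'a measure" and J :: nat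
    and tau :: "nat \<Rightarrow> nat \<Rightarrow> nat" and nu theta :: "nat \<Rightarrow> nat \<Rightarrow> real"
    and eps Y :: "nat \<Rightarrow> nat \<Rightarrow> 'a \<Rightarrow> real"
    and theta_bar Delta_low Xi C sigma_max :: real
    and Delta :: "nat \<Rightarrow> real" and law :: "nat \<Rightarrow> real measure"
    and K1 \<gamma> c :: real and K :: int and N1 w rho :: "nat \<Rightarrow> real" and m :: "nat \<Rightarrow> nat"
    and Jhat :: "nat \<Rightarrow> 'a \<Rightarrow> nat" and tau1 nu1 :: "nat \<Rightarrow> nat \<Rightarrow> 'a \<Rightarrow> real"
    and tau2 :: "nat \<Rightarrow> nat \<Rightarrow> 'a \<Rightarrow> nat"
    and P :: "'b measure" and eps_star :: "nat \<Rightarrow> int \<Rightarrow> 'b \<Rightarrow> real"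
  assumes prob: "\<And>N. prob_space (M N)"
    and signal: "\<forall>\<^sub>F N in sequentially.
          piecewise_constant_signal N J (tau N) (nu N) (theta N)"
    and observations: "\<And>N i \<omega>. Y N i \<omega> = theta N i + eps N i \<omega>"
    and M1: "theta_bar > 0"
      "\<forall>\<^sub>F N in sequentially. \<forall>i\<in>{1..N}. \<bar>theta N i\<bar> \<le> theta_bar"
    and M2: "Delta_low > 0"
      "\<forall>\<^sub>F N in sequentially. \<forall>j\<in>{1..J}. \<bar>nu N j - nu N (j - 1)\<bar> \<ge> Delta_low"
    and M3: "0 \<le> Xi" "Xi < 1" "C > 0"
      "\<forall>\<^sub>F N in sequentially. min_spacing J (tau N) \<ge> C * real N powr (1 - Xi)"
    and M4: "sigma_max > 0"
      "\<forall>\<^sub>F N in sequentially. prob_space.indep_vars (M N) (\<lambda>_. borel) (eps N) {1..N}"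
      "\<forall>\<^sub>F N in sequentially. \<forall>i\<in>{1..N}. integrable (M N) (eps N i) \<and>
          (\<integral>\<omega>. eps N i \<omega> \<partial>M N) = 0 \<and> subgaussian (M N) sigma_max (eps N i)"
    and M5: "\<forall>\<^sub>F N in sequentially. \<forall>j\<in>{1..J}. nu N j - nu N (j - 1) = Delta j"
    and M6: "\<forall>\<^sub>F N in sequentially. \<forall>j\<le>J. \<forall>i\<in>{tau N j + 1..tau N (Suc j)}.
          distr (M N) borel (eps N i) = law j"
    and stage1: "K1 > 0" "Xi < \<gamma>" "\<gamma> < 1"
      "\<And>N. N1 N = K1 * real N powr \<gamma>"
      "(\<lambda>N. real N / N1 N) \<in> o(\<lambda>N. min_spacing J (tau N))"
      "\<And>N. m N = nat \<lfloor>real N / N1 N\<rfloor>"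
    and stage1_estimators:
      "\<And>N. statistic_of (M N) (subsample (m N) N) (Y N) (count_space UNIV) (Jhat N)"
      "\<And>N i. statistic_of (M N) (subsample (m N) N) (Y N) borel (tau1 N i)"
      "\<And>N i. statistic_of (M N) (subsample (m N) N) (Y N) borel (nu1 N i)"
    and stage1_rates: "filterlim w at_top sequentially"
      "w \<in> o(\<lambda>N. min_spacing J (tau N))"
      "c > 0" "\<forall>\<^sub>F N in sequentially. w N > c * real N powr (1 - \<gamma>)"
      "rho \<longlonglongrightarrow> 0"
    and stage1_consistency:
      "(\<lambda>N. measure (M N) {\<omega> \<in> space (M N). Jhat N \<omega> = J \<and>
          (\<forall>i\<in>{1..J}. \<bar>tau1 N i \<omega> - real (tau N i)\<bar> \<le> w N) \<and>
          (\<forall>i\<in>{0..J}. \<bar>nu1 N i \<omega> - nu N i\<bar> \<le> rho N)}) \<longlonglongrightarrow> 1"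
    and stage2: "K > 1"
      "\<And>N i \<omega>. \<omega> \<in> space (M N) \<Longrightarrow> 1 \<le> i \<Longrightarrow> i \<le> Jhat N \<omega> \<Longrightarrow>
         tau2 N i \<omega> = second_stage_estimator (\<lambda>j. Y N j \<omega>)
           (second_stage_set (m N) N (of_int K * w N) (tau1 N i \<omega>))
           (nu1 N (i - 1) \<omega>) (nu1 N i \<omega>)"
    and star: "prob_space P"
      "prob_space.indep_vars P (\<lambda>_. borel) (\<lambda>(j, k). eps_star j k) ({0..J} \<times> UNIV)"
      "\<And>j k. j \<le> J \<Longrightarrow> distr P borel (eps_star j k) = law j"
  shows
    "((\<forall>j\<in>{1..J}. Delta j < 0 \<longrightarrow> symmetric_law (law (j - 1)) \<and> symmetric_law (law j)) \<longrightarrow>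
      (\<forall>L. (\<forall>j\<in>{1..J}.
              as_argmin P (limit_process \<bar>Delta j\<bar> (eps_star (j - 1)) (eps_star j)) (L j)) \<longrightarrow>
        (\<forall>k. (\<lambda>N. measure (M N) {\<omega> \<in> space (M N). Jhat N \<omega> = J \<and>
                 (\<forall>j\<in>{1..J}. lambda2 (m N) N (tau N j) (tau2 N j \<omega>) = k j)})
             \<longlonglongrightarrow> (\<Prod>j\<in>{1..J}. measure P {\<omega> \<in> space P. L j \<omega> = k j}))))
     \<and>
     (\<forall>L. (\<forall>j\<in>{1..J}.
              as_argmin P (limit_process (Delta j) (eps_star (j - 1)) (eps_star j)) (L j)) \<longrightarrow>
        (\<forall>k. (\<lambda>N. measure (M N) {\<omega> \<in> space (M N). Jhat N \<omega> = J \<and>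
                 (\<forall>j\<in>{1..J}. lambda2 (m N) N (tau N j) (tau2 N j \<omega>) = k j)})
             \<longlonglongrightarrow> (\<Prod>j\<in>{1..J}. measure P {\<omega> \<in> space P. L j \<omega> = k j})))"
proof -
  interpret P: prob_space P by fact
  \<comment> \<open>Row \<open>j\<close> splices the noise of segment \<open>j\<close> on the right
    with that of segment \<open>j - 1\<close> on the left.\<close>
  define X where "X = (\<lambda>(j, i). if 0 < i then eps_star j i else eps_star (j - 1) i)"
  \<comment> \<open>The family \<open>eps_star j\<close> can serve two rows, \<open>j\<close> with
    its positive and \<open>j + 1\<close> with its other indices. These are disjoint, so
    \<open>f\<close> is injective and neighbouring walks stay independent.\<close>
  define f where "f = (\<lambda>(j :: nat, i :: int). if 0 < i then (j, i) else (j - 1, i))"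
  have inj: "inj_on f ({1..J} \<times> UNIV)"
    by (auto simp: inj_on_def f_def split: if_splits)
  have ind: "P.indep_vars (\<lambda>_. borel) (\<lambda>(j, k). eps_star j k) (f ` ({1..J} \<times> UNIV))"
    by (rule P.indep_vars_subset[OF star(2)]) (auto simp: f_def split: if_splits)
  have "P.indep_vars (\<lambda>_. borel) (\<lambda>p. (\<lambda>(j, k). eps_star j k) (f p)) ({1..J} \<times> UNIV)"
    by (rule P.indep_vars_reindex[OF ind inj])
  moreover have "(\<lambda>p. (\<lambda>(j, k). eps_star j k) (f p)) = X"
    by (auto simp: X_def f_def fun_eq_iff)
  ultimately have indX: "P.indep_vars (\<lambda>_. borel) X ({1..J} \<times> UNIV)"
    by simp
  have margX: "distr P borel (X (j, i)) = law (if 0 < i then j else j - 1)" if "j \<in> {1..J}" for j i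
    using star(3)[of j i] star(3)[of "j - 1" i] that by (auto simp: X_def)
  have X: "X (j, i) \<in> borel_measurable P" if "j \<in> {1..J}" for j i
    using indX that by (auto simp: P.indep_vars_def)
  have lp: "limit_process a (eps_star (j - 1)) (eps_star j) = (\<lambda>k \<omega>. walk a (\<lambda>i. X (j, i) \<omega>) k)" for a j
    by (simp add: fun_eq_iff limit_process_eq_walk X_def if_distrib[of "\<lambda>f. f _"] cong: if_cong)
  have "\<forall>\<^sub>F N in sequentially. \<forall>j\<in>{1..J}. \<bar>Delta j\<bar> \<ge> Delta_low"
    using M2(2) M5 by eventually_elim auto
  \<comment> \<open>The inequality does not involve \<open>N\<close>, so holding eventually means
    holding.\<close>
  then have low: "\<forall>j\<in>{1..J}. \<bar>Delta j\<bar> \<ge> Delta_low"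
    by (simp only: eventually_const sequentially_bot not_False_eq_True)
  have Delta: "Delta j \<noteq> 0" if "j \<in> {1..J}" for j
    using M2(1) bspec[OF low that] by auto
  have sub: "\<forall>\<^sub>F N in sequentially. \<forall>i\<in>{1..N}. subgaussian (M N) sigma_max (eps N i)"
    using M4(3) by eventually_elim auto
  have m: "\<forall>\<^sub>F N in sequentially. 2 \<le> m N"
    unfolding stage1(4,6) by (rule eventually_le_subsampling_step[OF stage1(1,3)])
  note limit = second_stage_limit[OF prob signal observations M5 Delta M4(1,2) sub M6 m stage1_estimators
      stage1_rates(1,2,5) stage1_consistency stage2 star(1)]
  show ?thesis
  proof (intro conjI impI allI)
    fix L k
    assume "\<forall>j\<in>{1..J}. as_argmin P (limit_process (Delta j) (eps_star (j - 1)) (eps_star j)) (L j)"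
    then show "(\<lambda>N. measure (M N) {\<omega> \<in> space (M N). Jhat N \<omega> = J \<and>
        (\<forall>j\<in>{1..J}. lambda2 (m N) N (tau N j) (tau2 N j \<omega>) = k j)})
      \<longlonglongrightarrow> (\<Prod>j\<in>{1..J}. measure P {\<omega> \<in> space P. L j \<omega> = k j})"
      unfolding lp by (intro limit[OF _ _ _ _ indX margX]) auto
  next
    fix L k
    assume sym: "\<forall>j\<in>{1..J}. Delta j < 0 \<longrightarrow> symmetric_law (law (j - 1)) \<and> symmetric_law (law j)"
      and L: "\<forall>j\<in>{1..J}. as_argmin P (limit_process \<bar>Delta j\<bar> (eps_star (j - 1)) (eps_star j)) (L j)"
    \<comment> \<open>Negating the rows of the downward jumps turns the walk with the size of the
      jump into the one with the signed jump; symmetry keeps the marginals.\<close>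
    define X' where "X' = (\<lambda>(j, i) \<omega>. sgn (Delta j) * X (j, i) \<omega>)"
    have "P.indep_vars (\<lambda>_. borel) (\<lambda>p \<omega>. (\<lambda>x. sgn (Delta (fst p)) * x) (X p \<omega>)) ({1..J} \<times> UNIV)"
      by (rule P.indep_vars_compose2[OF indX]) simp
    then have indX': "P.indep_vars (\<lambda>_. borel) X' ({1..J} \<times> UNIV)"
      by (simp add: X'_def case_prod_beta')
    have margX': "distr P borel (X' (j, i)) = law (if 0 < i then j else j - 1)" if j: "j \<in> {1..J}" for j i
    proof (cases "Delta j < 0")
      case True
      have "distr P borel (X' (j, i)) = distr (distr P borel (X (j, i))) borel uminus"
        using True X[OF j] by (subst distr_distr) (auto simp: X'_def o_def)
      also have "\<dots> = law (if 0 < i then j else j - 1)"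
        using sym True j unfolding margX[OF j] by (auto simp: symmetric_law_def)
      finally show ?thesis .
    next
      case False
      then have "X' (j, i) = X (j, i)"
        using Delta[OF j] by (simp add: X'_def)
      then show ?thesis
        using margX[OF j] by simp
    qed
    have "walk \<bar>Delta j\<bar> (\<lambda>i. X (j, i) \<omega>) k = walk (Delta j) (\<lambda>i. X' (j, i) \<omega>) k" if "j \<in> {1..J}" for j k \<omega>
      using walk_sign[of "sgn (Delta j)" "Delta j"] Delta[OF that]
      by (simp add: X'_def abs_sgn mult.commute)
    with L have "as_argmin P (\<lambda>k \<omega>. walk (Delta j) (\<lambda>i. X' (j, i) \<omega>) k) (L j)" if "j \<in> {1..J}" for j
      using that unfolding lp by auto
    then show "(\<lambda>N. measure (M N) {\<omega> \<in> space (M N). Jhat N \<omega> = J \<and>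
        (\<forall>j\<in>{1..J}. lambda2 (m N) N (tau N j) (tau2 N j \<omega>) = k j)})
      \<longlonglongrightarrow> (\<Prod>j\<in>{1..J}. measure P {\<omega> \<in> space P. L j \<omega> = k j})"
      by (intro limit[OF _ _ _ _ indX' margX']) auto
  qed
qed

end
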